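(* Consider the varying-coefficient model with isotropic Gaussian process prior described in the context, with label space $\mathcal{Y}=\{0,1\}$ and with $p(y_i\mid\mathbf{x}_i,\mathbf{w}_i)$ given by a generalized linear model, defined by $z_i\sim\mathcal{N}(z\mid\mathbf{w}_i^{\mathsf T}\mathbf{x}_i,\tau^2)$ and $y_i\sim p(y\mid z_i)$ for $i=1,\dots,n$, and $p(y_\star\mid\mathbf{x}_\star,\mathbf{w}_\star)$ given by $z_\star\sim\mathcal{N}(z\mid\mathbf{w}_\star^{\mathsf T}\mathbf{x}_\star,\tau^2)$ and $y_\star\sim p(y\mid z_\star)$, where $\tau>0$ and $p(y\mid z)$ is a likelihood generating labels $y\in\{0,1\}$ given $z\in\mathbb{R}$. Let $\mathbf{z}=(z_1,\dots,z_n)^{\mathsf T}\in\mathbb{R}^n$ and $p(\mathbf{y}\mid\mathbf{z})=\prod_{i=1}^n p(y_i\mid z_i)$. Let the task kernel matrix $\mathbf{K}_{\mathbf{T}}=\big(k_{\mathcal{T}}(\mathbf{t}_i,\mathbf{t}_j)\big)_{i,j=1}^n$ be positive definite, let $\mathbf{K}\in\mathbb{R}^{n\times n}$ be the matrix with components $k_{ij}=\mathbf{x}_i^{\mathsf T}\mathbf{x}_j\,k_{\mathcal{T}}(\mathbf{t}_i,\mathbf{t}_j)$, and let $\mathbf{k}\in\mathbb{R}^n$ be the vector with components $k_i=\mathbf{x}_i^{\mathsf T}\mathbf{x}_\star\,k_{\mathcal{T}}(\mathbf{t}_i,\mathbf{t}_\star)$. Then the predictive distribution satisfies $$p(y_\star\mid\mathbf{X},\mathbf{y},\mathbf{T},\mathbf{x}_\star,\mathbf{t}_\star)\propto\iint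 p(y_\star\mid z_\star)\,\mathcal{N}(z_\star\mid\mu_{\mathbf{z}},\sigma_{\mathbf{z}}^2)\,p(\mathbf{y}\mid\mathbf{z})\,\mathcal{N}(\mathbf{z}\mid\mathbf{0},\mathbf{K}+\tau^2\mathbf{I}_{n\times n})\,\mathrm{d}\mathbf{z}\,\mathrm{d}z_\star,$$ where the proportionality constant does not depend on $y_\star\in\{0,1\}$, and $$\mu_{\mathbf{z}}=\mathbf{k}^{\mathsf T}(\mathbf{K}+\tau^2\mathbf{I}_{n\times n})^{-1}\mathbf{z},\qquad \sigma_{\mathbf{z}}^2=\mathbf{x}_\star^{\mathsf T}\mathbf{x}_\star\,k_{\mathcal{T}}(\mathbf{t}_\star,\mathbf{t}_\star)-\mathbf{k}^{\mathsf T}(\mathbf{K}+\tau^2\mathbf{I}_{n\times n})^{-1}\mathbf{k}+\tau^2.$$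
   Context: Notation: $\mathcal{N}(\cdot\mid\mu,v)$ is the (uni- or multivariate) normal density with mean $\mu$ and (co)variance $v$; $\mathbf{I}_{m\times m}$ is the identity matrix; $\mathbf{X}\in\mathbb{R}^{n\times m}$ has rows $\mathbf{x}_1^{\mathsf T},\dots,\mathbf{x}_n^{\mathsf T}$; $\mathbf{T}$ collects $\mathbf{t}_1,\dots,\mathbf{t}_n$. Varying-coefficient model with isotropic Gaussian process prior: Let $\mathcal{T}$ be a set (of task variables) and $k_{\mathcal{T}}:\mathcal{T}\times\mathcal{T}\to\mathbb{R}$ a positive semidefinite kernel. The instances $\mathbf{x}_1,\dots,\mathbf{x}_n,\mathbf{x}_\star\in\mathcal{X}\subseteq\mathbb{R}^m$ and task variables $\mathbf{t}_1,\dots,\mathbf{t}_n,\mathbf{t}_\star\in\mathcal{T}$ are fixed (non-random). A random function $\boldsymbol\omega:\mathcal{T}\to\mathbb{R}^m$ is drawn from the zero-mean vector-valued Gaussian process $\mathcal{GP}(\mathbf{0},\boldsymbol\kappa)$ with the isotropic matrix-valued kernel $\boldsymbol\kappa(\mathbf{t},\mathbf{t}')=k_{\mathcal{T}}(\mathbf{t},\mathbf{t}')\,\mathbf{I}_{m\times m}$, i.e. all finite-dimensional evaluations of $\boldsymbol\omega$ are jointly Gaussian with mean zero and $\mathrm{Cov}(\boldsymbol\omega(\mathbf{t})_s,\boldsymbol\omega(\mathbf{t}')_r)=\boldsymbol\kappa(\mathbf{t},\mathbf{t}')_{s,r}$. Set $\mathbf{w}_i=\boldsymbol\omega(\mathbf{t}_i)$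 and $\mathbf{w}_\star=\boldsymbol\omega(\mathbf{t}_\star)$. Given $\boldsymbol\omega$, the labels $y_1,\dots,y_n,y_\star$ (together with their latent variables $z_1,\dots,z_n,z_\star$) are drawn independently from the observation models $p(y\mid\mathbf{x}_i,\mathbf{w}_i)$ and $p(y\mid\mathbf{x}_\star,\mathbf{w}_\star)$. For each $z\in\mathbb{R}$, $p(\cdot\mid z)$ is a probability mass function on $\{0,1\}$, (measurable in $z$). The predictive distribution $p(y_\star\mid\mathbf{X},\mathbf{y},\mathbf{T},\mathbf{x}_\star,\mathbf{t}_\star)$ is the conditional distribution of $y_\star$ given that the training labels equal $\mathbf{y}\in\{0,1\}^n$ under this model (for $\mathbf{y}$ of positive marginal probability, so that the conditional distribution is defined). *)

theory Defs
  imports "HOL-Probability.Probability"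
begin

section \<open>Matrices, kernels and normal densities\<close>

definition positive_definite :: "real^'n^'n \<Rightarrow> bool" where
  "positive_definite A \<longleftrightarrow> transpose A = A \<and> (\<forall>v. v \<noteq> 0 \<longrightarrow> 0 < v \<bullet> (A *v v))"

definition psd_kernel :: "'t set \<Rightarrow> ('t \<Rightarrow> 't \<Rightarrow> real) \<Rightarrow> bool" where
  "psd_kernel T k \<longleftrightarrow>
     (\<forall>s\<in>T. \<forall>t\<in>T. k s t = k t s) \<and>
     (\<forall>S c. finite S \<longrightarrow> S \<subseteq> T \<longrightarrow> 0 \<le> (\<Sum>s\<in>S. \<Sum>t\<in>S. c s * c t * k s t))"

definition isotropic_kernel :: "('t \<Rightarrow> 't \<Rightarrow> real) \<Rightarrow> 't \<Rightarrow> 't \<Rightarrow> real^'m^'m" where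
  "isotropic_kernel k s t = k s t *\<^sub>R mat 1"

text \<open>Density of the multivariate normal distribution with mean \<open>\<mu>\<close> and (invertible)
  covariance matrix \<open>\<Sigma>\<close>. The univariate \<^const>\<open>normal_density\<close> of the library is
  parametrised by the standard deviation rather than the variance.\<close>

definition mvn_density :: "real^'n \<Rightarrow> real^'n^'n \<Rightarrow> real^'n \<Rightarrow> real" where
  "mvn_density \<mu> \<Sigma> z =
     exp (- ((z - \<mu>) \<bullet> (matrix_inv \<Sigma> *v (z - \<mu>))) / 2) / sqrt ((2 * pi) ^ CARD('n) * det \<Sigma>)"


section \<open>Gaussian processes\<close>

text \<open>The normal distribution with variance \<open>v \<ge> 0\<close>; for \<open>v = 0\<close> it is the point mass at \<open>\<mu>\<close>.\<close>

definition normal_measure :: "real \<Rightarrow> real \<Rightarrow> real measure" where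
  "normal_measure \<mu> v =
     (if v = 0 then return borel \<mu> else density lborel (\<lambda>z. ennreal (normal_density \<mu> (sqrt v) z)))"

definition gaussian_rv :: "'a measure \<Rightarrow> ('a \<Rightarrow> real) \<Rightarrow> bool" where
  "gaussian_rv M X \<longleftrightarrow>
     X \<in> borel_measurable M \<and> (\<exists>\<mu> v. 0 \<le> v \<and> distr M borel X = normal_measure \<mu> v)"

text \<open>A vector-valued Gaussian process on \<open>T\<close> with mean function \<open>m\<close> and matrix-valued kernel
  \<open>\<kappa>\<close>. Joint normality (possibly degenerate) of all finite-dimensional evaluations means that
  every linear combination of finitely many coordinates \<open>\<omega> t $ s\<close> is normal.\<close>

definition gaussian_process ::
    "'a measure \<Rightarrow> 't set \<Rightarrow> ('t \<Rightarrow> real^'m) \<Rightarrow> ('t \<Rightarrow> 't \<Rightarrow> real^'m^'m) \<Rightarrow> ('t \<Rightarrow> 'a \<Rightarrow> real^'m) \<Rightarrow> bool"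
  where
  "gaussian_process M T m \<kappa> \<omega> \<longleftrightarrow>
     (\<forall>t\<in>T. \<omega> t \<in> borel_measurable M) \<and>
     (\<forall>S c. finite S \<longrightarrow> S \<subseteq> T \<longrightarrow> gaussian_rv M (\<lambda>\<xi>. \<Sum>t\<in>S. c t \<bullet> \<omega> t \<xi>)) \<and>
     (\<forall>t\<in>T. \<forall>s. (\<integral>\<xi>. \<omega> t \<xi> $ s \<partial>M) = m t $ s) \<and>
     (\<forall>t\<in>T. \<forall>t'\<in>T. \<forall>s r.
        (\<integral>\<xi>. (\<omega> t \<xi> $ s - m t $ s) * (\<omega> t' \<xi> $ r - m t' $ r) \<partial>M) = \<kappa> t t' $ s $ r)"

text \<open>The \<open>\<sigma>\<close>-algebra generated by the process, used for conditioning on \<open>\<omega>\<close>.\<close>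

definition process_algebra ::
    "'a measure \<Rightarrow> 't set \<Rightarrow> ('t \<Rightarrow> 'a \<Rightarrow> real^'m) \<Rightarrow> 'a measure" where
  "process_algebra M T \<omega> =
     vimage_algebra (space M) (\<lambda>\<xi>. \<lambda>t\<in>T. \<omega> t \<xi>) (\<Pi>\<^sub>M t\<in>T. borel)"


section \<open>Observation models\<close>

definition binary_likelihood :: "(real \<Rightarrow> nat pmf) \<Rightarrow> bool" where
  "binary_likelihood p \<longleftrightarrow>
     (\<forall>z. set_pmf (p z) \<subseteq> {0, 1}) \<and> (\<forall>b. (\<lambda>z. pmf (p z) b) \<in> borel_measurable borel)"

text \<open>Joint law of the latent variable and the label \<open>(z, y)\<close> in a generalized linear model with
  instance \<open>x\<close> and weights \<open>w\<close>: first \<open>z \<sim> N(w\<^sup>T x, \<tau>\<^sup>2)\<close>, then \<open>y \<sim> p(\<cdot> | z)\<close>.\<close>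

definition glm_observation ::
    "(real \<Rightarrow> nat pmf) \<Rightarrow> real \<Rightarrow> real^'m \<Rightarrow> real^'m \<Rightarrow> (real \<times> nat) measure" where
  "glm_observation p \<tau> x w =
     normal_measure (w \<bullet> x) (\<tau>\<^sup>2) \<bind>
       (\<lambda>z. distr (measure_pmf (p z)) (borel \<Otimes>\<^sub>M count_space UNIV) (\<lambda>b. (z, b)))"

text \<open>Given \<open>\<omega>\<close>, the pairs \<open>(Z i, Y i)\<close> for \<open>i :: 'n\<close> and \<open>(Zs, Ys)\<close> are independent and
  distributed according to their observation models: the conditional probability given \<open>\<omega>\<close> of
  every measurable rectangle is the product of the individual probabilities.\<close>

definition drawn_independently_given ::
    "'a measure \<Rightarrow> 't set \<Rightarrow> ('t \<Rightarrow> 'a \<Rightarrow> real^'m) \<Rightarrow> (real^'m \<Rightarrow> real^'m \<Rightarrow> (real \<times> nat) measure) \<Rightarrow>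
     ('n::finite \<Rightarrow> real^'m) \<Rightarrow> ('n \<Rightarrow> 't) \<Rightarrow> real^'m \<Rightarrow> 't \<Rightarrow>
     ('n \<Rightarrow> 'a \<Rightarrow> real) \<Rightarrow> ('n \<Rightarrow> 'a \<Rightarrow> nat) \<Rightarrow> ('a \<Rightarrow> real) \<Rightarrow> ('a \<Rightarrow> nat) \<Rightarrow> bool"
  where
  "drawn_independently_given M T \<omega> obs x t xs ts Z Y Zs Ys \<longleftrightarrow>
     (\<forall>i. Z i \<in> borel_measurable M \<and> Y i \<in> measurable M (count_space UNIV)) \<and>
     Zs \<in> borel_measurable M \<and> Ys \<in> measurable M (count_space UNIV) \<and>
     (\<forall>A As. (\<forall>i. A i \<in> sets (borel \<Otimes>\<^sub>M count_space UNIV)) \<longrightarrow>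
        As \<in> sets (borel \<Otimes>\<^sub>M count_space UNIV) \<longrightarrow>
        (AE \<xi> in M.
           real_cond_exp M (process_algebra M T \<omega>)
             (indicator {\<xi> \<in> space M. (\<forall>i. (Z i \<xi>, Y i \<xi>) \<in> A i) \<and> (Zs \<xi>, Ys \<xi>) \<in> As}) \<xi> =
           (\<Prod>i\<in>UNIV. measure (obs (x i) (\<omega> (t i) \<xi>)) (A i)) * measure (obs xs (\<omega> ts \<xi>)) As))"

end

theory Submission
  imports Defs
begin

text \<open>Put \<open>U\<^sub>i = w\<^sub>i\<^sup>T x\<^sub>i\<close> and \<open>U\<^sub>\<star> = w\<^sub>\<star>\<^sup>T x\<^sub>\<star>\<close>. Integrating out the labels,
  the joint probability of \<open>y\<close> and \<open>y\<^sub>\<star>\<close> is the integral of \<open>p(y\<^sub>\<star> | z\<^sub>\<star>) p(y | z)\<close> against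
  the density of \<open>(U, U\<^sub>\<star>)\<close> smoothed by independent \<open>N(0, \<tau>\<^sup>2)\<close> noise. The vector \<open>(U, U\<^sub>\<star>)\<close> may
  be degenerate, but its characteristic function \<open>exp (- s \<bullet> S s / 2)\<close> is known. Writing the Gaussian
  noise kernel as a Fourier integral and interchanging it with the expectation, the smoothed density
  becomes the Fourier transform of \<open>exp (- s \<bullet> A s / 2)\<close> with the positive definite
  \<open>A = S + \<tau>\<^sup>2 I\<close>, that is, a constant times \<open>exp (- z \<bullet> A\<^sup>-\<^sup>1 z / 2)\<close>, which factors by the Schur complement of
  \<open>K + \<tau>\<^sup>2 I\<close> in \<open>A\<close>. Constants are never computed, since they are absorbed in the factor of
  proportionality.\<close>

section \<open>Fourier transforms of Gaussian densities\<close>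

text \<open>This is the known characteristic function of the standard normal distribution, with the
  normalising factor of the density moved to the other side.\<close>

lemma gaussian_fourier_1:
  fixes t :: real
  shows "integrable lborel (\<lambda>u. iexp (t * u) * complex_of_real (exp (- u\<^sup>2 / 2)))"
    and "(\<integral>u. iexp (t * u) * complex_of_real (exp (- u\<^sup>2 / 2)) \<partial>lborel) = complex_of_real (sqrt (2 * pi) * exp (- t\<^sup>2 / 2))"
proof -
  interpret real_distribution std_normal_distribution
    by (rule real_dist_normal_dist)
  have eq: "iexp (t * u) * complex_of_real (exp (- u\<^sup>2 / 2)) =
      complex_of_real (sqrt (2 * pi)) * (std_normal_density u *\<^sub>R iexp (t * u))" for u
    by (simp add: std_normal_density_def scaleR_conv_of_real)
  have "integrable std_normal_distribution (\<lambda>u. iexp (t * u))"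
    by (rule integrable_iexp) simp_all
  then have i: "integrable lborel (\<lambda>u. std_normal_density u *\<^sub>R iexp (t * u))"
    by (subst (asm) integrable_density) simp_all
  then show "integrable lborel (\<lambda>u. iexp (t * u) * complex_of_real (exp (- u\<^sup>2 / 2)))"
    unfolding eq by (intro integrable_mult_right)
  have "char std_normal_distribution t = (\<integral>u. std_normal_density u *\<^sub>R iexp (t * u) \<partial>lborel)"
    unfolding char_def by (subst integral_density) simp_all
  then show "(\<integral>u. iexp (t * u) * complex_of_real (exp (- u\<^sup>2 / 2)) \<partial>lborel) = complex_of_real (sqrt (2 * pi) * exp (- t\<^sup>2 / 2))"
    unfolding eq integral_mult_right_zero by (simp add: char_std_normal_distribution)
qed

text \<open>Lebesgue measure on a Euclidean space is the image under \<open>S\<close> of a product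
  of one-dimensional Lebesgue measures. Both factors of the integrand split over the coordinates, so
  each coordinate contributes one copy of \<open>gaussian_fourier_1\<close>.\<close>

lemma gaussian_fourier_standard:
  fixes z :: "'a::euclidean_space"
  shows "integrable lborel (\<lambda>s. iexp (s \<bullet> z) * complex_of_real (exp (- (s \<bullet> s) / 2)))"
    and "(\<integral>s. iexp (s \<bullet> z) * complex_of_real (exp (- (s \<bullet> s) / 2)) \<partial>lborel) =
      complex_of_real (sqrt (2 * pi) ^ DIM('a) * exp (- (z \<bullet> z) / 2))"
proof -
  interpret product_sigma_finite "\<lambda>_::'a. lborel :: real measure"
    by standard
  define g where "g b u = iexp ((z \<bullet> b) * u) * complex_of_real (exp (- u\<^sup>2 / 2))" for b and u :: real
  define S :: "('a \<Rightarrow> real) \<Rightarrow> 'a" where "S f = (\<Sum>b\<in>Basis. f b *\<^sub>R b)" for f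
  have S [measurable]: "S \<in> measurable (\<Pi>\<^sub>M b\<in>Basis. lborel) borel"
    unfolding S_def by measurable
  have lb: "lborel = distr (\<Pi>\<^sub>M b\<in>Basis. lborel) borel S"
    unfolding S_def by (rule lborel_eq)
  have inner_Basis_sum: "x \<bullet> y = (\<Sum>b\<in>Basis. (x \<bullet> b) * (y \<bullet> b))" for x y :: 'a
    by (rule euclidean_inner)
  have eq: "iexp (S f \<bullet> z) * complex_of_real (exp (- (S f \<bullet> S f) / 2)) = (\<Prod>b\<in>Basis. g b (f b))" for f
  proof -
    have c: "S f \<bullet> b = f b" if "b \<in> Basis" for b
      unfolding S_def using that by simp
    have "S f \<bullet> z = (\<Sum>b\<in>Basis. (z \<bullet> b) * f b)"
      by (subst inner_Basis_sum) (simp add: c mult.commute)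
    moreover have "- (S f \<bullet> S f) / 2 = (\<Sum>b\<in>Basis. - (f b)\<^sup>2 / 2)"
      by (subst inner_Basis_sum)
        (simp add: c power2_eq_square sum_negf sum_divide_distrib flip: sum_divide_distrib)
    ultimately show ?thesis
      by (simp add: g_def exp_sum prod.distrib sum_distrib_left flip: exp_of_real)
  qed
  have meas: "(\<lambda>s. iexp (s \<bullet> z) * complex_of_real (exp (- (s \<bullet> s) / 2))) \<in> borel_measurable borel"
    by measurable
  have gi: "integrable lborel (g b)" for b
    unfolding g_def by (rule gaussian_fourier_1)
  show "integrable lborel (\<lambda>s. iexp (s \<bullet> z) * complex_of_real (exp (- (s \<bullet> s) / 2)))"
    unfolding lb by (subst integrable_distr_eq[OF S meas], unfold eq)
      (intro product_integrable_prod finite_Basis gi)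
  have "(\<integral>s. iexp (s \<bullet> z) * complex_of_real (exp (- (s \<bullet> s) / 2)) \<partial>lborel) = (\<Prod>b\<in>Basis. integral\<^sup>L lborel (g b))"
    by (subst lb, subst integral_distr[OF S meas], unfold eq)
      (intro product_integral_prod finite_Basis gi)
  also have "\<dots> = (\<Prod>b\<in>(Basis::'a set). complex_of_real (sqrt (2 * pi) * exp (- (z \<bullet> b)\<^sup>2 / 2)))"
    unfolding g_def by (simp only: gaussian_fourier_1(2))
  also have "\<dots> = complex_of_real (sqrt (2 * pi) ^ DIM('a) * exp (\<Sum>b\<in>(Basis::'a set). - (z \<bullet> b)\<^sup>2 / 2))"
    by (simp only: exp_sum[OF finite_Basis] of_real_prod[symmetric] prod.distrib prod_constant)
  also have "(\<Sum>b\<in>(Basis::'a set). - (z \<bullet> b)\<^sup>2 / 2) = - (z \<bullet> z) / 2"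
    by (subst (2) inner_Basis_sum)
        (simp add: power2_eq_square sum_negf sum_divide_distrib flip: sum_divide_distrib)
  finally show "(\<integral>s. iexp (s \<bullet> z) * complex_of_real (exp (- (s \<bullet> s) / 2)) \<partial>lborel) =
      complex_of_real (sqrt (2 * pi) ^ DIM('a) * exp (- (z \<bullet> z) / 2))" .
qed

section \<open>Linear changes of variables for Lebesgue measure\<close>

lemma nn_integral_lborel_translate:
  fixes f :: "'a::euclidean_space \<Rightarrow> ennreal"
  assumes [measurable]: "f \<in> borel_measurable borel"
  shows "(\<integral>\<^sup>+x. f (x + c) \<partial>lborel) = (\<integral>\<^sup>+x. f x \<partial>lborel)"
  by (subst (2) lborel_distr_plus[of c, symmetric], subst nn_integral_distr) (simp_all add: add.commute)

text \<open>The push-forward of Lebesgue measure under \<open>B\<close> is translation invariant; the computation below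
  is the usual proof that translation-invariant measures are proportional, with a symmetric ball as
  the test set.\<close>

lemma nn_integral_lborel_linear:
  fixes B :: "'a::euclidean_space \<Rightarrow> 'a"
  assumes "linear B" "bij B"
  obtains C :: real where "C > 0"
    and "\<And>f. f \<in> borel_measurable borel \<Longrightarrow> (\<integral>\<^sup>+x. f (B x) \<partial>lborel) = ennreal C * (\<integral>\<^sup>+x. f x \<partial>lborel)"
proof -
  define D where "D = inv B"
  have BD: "B (D y) = y" and DB: "D (B y) = y" for y
    using assms(2) by (simp_all add: D_def bij_is_surj surj_f_inv_f bij_is_inj)
  have linD: "linear D"
    unfolding D_def using assms bij_is_inj
    by (metis inj_linear_imp_inv_linear)
  have contB: "continuous_on S B" for S
    using assms(1) by (simp add: linear_continuous_on linear_conv_bounded_linear)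
  have [measurable]: "B \<in> borel_measurable borel"
    using contB by (rule borel_measurable_continuous_onI)
  \<comment> \<open>The ball is symmetric about 0, so \<open>g\<close> is even; below this turns
    \<open>g (- B x)\<close> into \<open>g (B x)\<close>.\<close>
  define g :: "'a \<Rightarrow> ennreal" where "g = indicator (ball 0 1)"
  have [measurable]: "g \<in> borel_measurable borel"
    unfolding g_def by (intro borel_measurable_indicator borel_open open_ball)
  have gm: "g (- x) = g x" for x
    by (simp add: g_def indicator_def)
  have key: "(\<integral>\<^sup>+x. g x \<partial>lborel) * (\<integral>\<^sup>+x. f (B x) \<partial>lborel) = (\<integral>\<^sup>+x. g (B x) \<partial>lborel) * (\<integral>\<^sup>+x. f x \<partial>lborel)"
    if [measurable]: "f \<in> borel_measurable borel" for f
  proof -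
    have "(\<integral>\<^sup>+x. g x \<partial>lborel) * (\<integral>\<^sup>+x. f (B x) \<partial>lborel) = (\<integral>\<^sup>+x. f (B x) * (\<integral>\<^sup>+y. g y \<partial>lborel) \<partial>lborel)"
      by (subst nn_integral_multc) (simp_all add: mult.commute)
    also have "\<dots> = (\<integral>\<^sup>+x. (\<integral>\<^sup>+y. f (B x) * g (y + - B x) \<partial>lborel) \<partial>lborel)"
      by (simp add: nn_integral_cmult nn_integral_lborel_translate[of g "- B x" for x, simplified])
    also have "\<dots> = (\<integral>\<^sup>+y. (\<integral>\<^sup>+x. f (B x) * g (y + - B x) \<partial>lborel) \<partial>lborel)"
      by (subst lborel_pair.Fubini') simp_all
    \<comment> \<open>Translating \<open>x\<close> by \<open>D y\<close> replaces \<open>B x\<close>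
      by \<open>B x + y\<close>. The argument of \<open>g\<close> becomes \<open>- B x\<close>, free
      of \<open>y\<close>, and that of \<open>f\<close> becomes \<open>y + B x\<close>, so a second
      interchange separates the two integrals.\<close>
    also have "\<dots> = (\<integral>\<^sup>+y. (\<integral>\<^sup>+x. f (B (x + D y)) * g (y + - B (x + D y)) \<partial>lborel) \<partial>lborel)"
      by (subst nn_integral_lborel_translate[of "\<lambda>x. f (B x) * g (_ + - B x)"]) simp_all
    also have "\<dots> = (\<integral>\<^sup>+y. (\<integral>\<^sup>+x. g (B x) * f (y + B x) \<partial>lborel) \<partial>lborel)"
      by (simp add: linear_add[OF assms(1)] BD gm mult.commute add.commute)
    also have "\<dots> = (\<integral>\<^sup>+x. (\<integral>\<^sup>+y. g (B x) * f (y + B x) \<partial>lborel) \<partial>lborel)"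
      by (subst lborel_pair.Fubini') simp_all
    also have "\<dots> = (\<integral>\<^sup>+x. g (B x) \<partial>lborel) * (\<integral>\<^sup>+x. f x \<partial>lborel)"
      by (simp add: nn_integral_cmult nn_integral_lborel_translate[of f] nn_integral_multc)
    finally show ?thesis .
  qed
  \<comment> \<open>Solving \<open>key\<close> for the integral of \<open>f (B x)\<close> requires
    the unit ball to have positive finite mass; the same property of its preimage makes the
    resulting factor a positive real.\<close>
  have fin: "emeasure lborel U \<noteq> 0 \<and> emeasure lborel U \<noteq> \<infinity>" if "open U" "bounded U" "U \<noteq> {}" for U :: "'a set"
  proof -
    obtain c where "c \<in> U"
      using \<open>U \<noteq> {}\<close> by blast
    with \<open>open U\<close> obtain e where ce: "e > 0" "ball c e \<subseteq> U"
      by (meson open_contains_ball)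
    have "0 < emeasure lborel (ball c e)"
      using ce content_ball_pos[of e c] emeasure_lborel_ball_finite[of c e]
      by (simp add: emeasure_eq_ennreal_measure less_top[symmetric])
    also have "\<dots> \<le> emeasure lborel U"
      using ce that by (intro emeasure_mono) auto
    finally show ?thesis
      using emeasure_bounded_finite[OF that(2)] by auto
  qed
  have 1: "(\<integral>\<^sup>+x. g x \<partial>lborel) = emeasure lborel (ball (0::'a) 1)"
    unfolding g_def by simp
  have im: "B -` ball 0 1 = D ` ball 0 1"
    unfolding D_def by (rule bij_vimage_eq_inv_image[OF assms(2)])
  have op: "open (B -` ball 0 1)"
    by (intro open_vimage open_ball contB)
  have 2: "(\<integral>\<^sup>+x. g (B x) \<partial>lborel) = emeasure lborel (B -` ball 0 1)"
    using nn_integral_indicator[of "B -` ball 0 1" lborel] op by (simp add: g_def indicator_vimage)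
  have f1: "emeasure lborel (ball (0::'a) 1) \<noteq> 0 \<and> emeasure lborel (ball (0::'a) 1) \<noteq> \<infinity>"
    by (intro fin) auto
  have f2: "emeasure lborel (B -` ball 0 1) \<noteq> 0 \<and> emeasure lborel (B -` ball 0 1) \<noteq> \<infinity>"
  proof (intro fin op)
    show "bounded (B -` ball 0 1)"
      unfolding im using linD by (intro bounded_linear_image) (auto simp: linear_conv_bounded_linear)
    show "B -` ball 0 1 \<noteq> {}"
      unfolding im by simp
  qed
  obtain p q where p: "emeasure lborel (ball (0::'a) 1) = ennreal p" "p > 0"
    and q: "emeasure lborel (B -` ball 0 1) = ennreal q" "q > 0"
    using f1 f2 by (metis ennreal_cases ennreal_eq_0_iff infinity_ennreal_def not_le)
  show thesis
  proof
    show "q / p > 0"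
      using p q by simp
    fix f :: "'a \<Rightarrow> ennreal" assume f: "f \<in> borel_measurable borel"
    have "ennreal (1 / p) * (ennreal p * (\<integral>\<^sup>+x. f (B x) \<partial>lborel)) = ennreal (1 / p) * (ennreal q * (\<integral>\<^sup>+x. f x \<partial>lborel))"
      using key[OF f] unfolding 1 2 p q by simp
    then show "(\<integral>\<^sup>+x. f (B x) \<partial>lborel) = ennreal (q / p) * (\<integral>\<^sup>+x. f x \<partial>lborel)"
      using p q by (simp add: mult.assoc[symmetric] flip: ennreal_mult)
  qed
qed

text \<open>As an identity of measures, the change of variables also applies to complex-valued
  Bochner integrals.\<close>

lemma distr_lborel_linear:
  fixes B :: "'a::euclidean_space \<Rightarrow> 'a"
  assumes "linear B" "bij B"
  obtains C :: real where "C > 0" "distr lborel borel B = density lborel (\<lambda>_. ennreal C)"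
proof -
  obtain C :: real where C: "C > 0"
    and eq: "\<And>f. f \<in> borel_measurable borel \<Longrightarrow> (\<integral>\<^sup>+x. f (B x) \<partial>lborel) = ennreal C * (\<integral>\<^sup>+x. f x \<partial>lborel)"
    using nn_integral_lborel_linear[OF assms] by blast
  have [measurable]: "B \<in> borel_measurable borel"
    by (rule borel_measurable_continuous_onI) (simp add: assms(1) linear_continuous_on linear_conv_bounded_linear[symmetric])
  have "distr lborel borel B = density lborel (\<lambda>_. ennreal C)"
  proof (rule measure_eqI)
    fix X assume "X \<in> sets (distr lborel borel B)"
    then have [measurable]: "X \<in> sets borel" by simp
    show "emeasure (distr lborel borel B) X = emeasure (density lborel (\<lambda>_. ennreal C)) X"
      using eq[of "indicator X"] nn_integral_indicator[of X "distr lborel borel B"]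
      by (simp add: emeasure_density nn_integral_cmult nn_integral_distr del: nn_integral_indicator)
  qed simp
  with C that show thesis by blast
qed

section \<open>Positive definite quadratic forms and smoothing by Gaussian noise\<close>

text \<open>The form \<open>x \<bullet> A y\<close> is an inner product, and the system is built one
  vector at a time: fewer than \<open>DIM('a)\<close> vectors \<open>A (f b)\<close> do not span the
  space, so a nonzero \<open>u\<close> is orthogonal to all of them, and it remains to normalise
  \<open>u\<close> in the form.\<close>

lemma orthonormal_system_exists:
  fixes A :: "'a::euclidean_space \<Rightarrow> 'a"
  assumes lin: "linear A" and sym: "\<And>x y. x \<bullet> A y = y \<bullet> A x" and pd: "\<And>x. x \<noteq> 0 \<Longrightarrow> 0 < x \<bullet> A x"
  obtains f :: "'a \<Rightarrow> 'a" where "\<And>b c. b \<in> Basis \<Longrightarrow> c \<in> Basis \<Longrightarrow> f b \<bullet> A (f c) = (if b = c then 1 else 0)"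
proof -
  \<comment> \<open>\<open>Basis\<close> serves as an index set with \<open>DIM('a)\<close>
    elements; the induction adds one index at a time.\<close>
  have "\<exists>f. \<forall>b\<in>I. \<forall>c\<in>I. f b \<bullet> A (f c) = (if b = c then 1 else 0)" if "I \<subseteq> (Basis :: 'a set)" for I
    using finite_subset[OF that finite_Basis] that
  proof (induction rule: finite_induct)
    case empty
    then show ?case by simp
  next
    case (insert a I)
    then obtain f where f: "f b \<bullet> A (f c) = (if b = c then 1 else 0)" if "b \<in> I" "c \<in> I" for b c
      by auto
    have "dim ((\<lambda>b. A (f b)) ` I) \<le> card I"
      using insert.hyps(1) by (meson card_image_le dim_le_card' finite_imageI le_trans)
    also have "\<dots> < DIM('a)"
      using insert by (intro psubset_card_mono) auto
    finally obtain u where u: "u \<noteq> 0" "\<And>y. y \<in> span ((\<lambda>b. A (f b)) ` I) \<Longrightarrow> orthogonal u y"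
      using orthogonal_to_subspace_exists by blast
    define w where "w = u /\<^sub>R sqrt (u \<bullet> A u)"
    have "w \<bullet> A w = 1"
      using pd[OF u(1)] by (simp add: w_def linear_cmul[OF lin] real_sqrt_mult_self field_simps)
    moreover have wf: "w \<bullet> A (f b) = 0" if "b \<in> I" for b
      using u(2)[OF span_base, of "A (f b)"] that by (simp add: w_def orthogonal_def)
    moreover have "f b \<bullet> A w = 0" if "b \<in> I" for b
      using wf[OF that] sym by metis
    ultimately show ?case
      using f insert.hyps(2) by (intro exI[of _ "f(a := w)"]) auto
  qed
  from this[of Basis] that show thesis by auto
qed

text \<open>Let \<open>B\<close> map the standard basis to an orthonormal system of the form given
  by \<open>A\<close>. The substitution \<open>s = B r\<close> turns \<open>s \<bullet> A s\<close>
  into \<open>r \<bullet> r\<close> and reduces the claim to the standard case, at the cost of a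
  constant factor. Writing the frequency as \<open>A w\<close> keeps the inverse of \<open>A\<close>
  out of the statement: for \<open>v = A w\<close> the exponent \<open>w \<bullet> A w\<close> is
  the quadratic form of the inverse at \<open>v\<close>.\<close>

lemma gaussian_fourier_pd:
  fixes A :: "'a::euclidean_space \<Rightarrow> 'a"
  assumes lin: "linear A" and sym: "\<And>x y. x \<bullet> A y = y \<bullet> A x" and pd: "\<And>x. x \<noteq> 0 \<Longrightarrow> 0 < x \<bullet> A x"
  obtains c where "c > 0"
    and "integrable lborel (\<lambda>s. exp (- (s \<bullet> A s) / 2))"
    and "\<And>w. (\<integral>s. iexp (s \<bullet> A w) * complex_of_real (exp (- (s \<bullet> A s) / 2)) \<partial>lborel) =
      complex_of_real (c * exp (- (w \<bullet> A w) / 2))"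
proof -
  obtain f :: "'a \<Rightarrow> 'a" where f: "\<And>b c. b \<in> Basis \<Longrightarrow> c \<in> Basis \<Longrightarrow> f b \<bullet> A (f c) = (if b = c then 1 else 0)"
    using orthonormal_system_exists[OF assms] by blast
  define B where "B r = (\<Sum>b\<in>Basis. (r \<bullet> b) *\<^sub>R f b)" for r
  have linB: "linear B"
    unfolding B_def by (intro linearI) (simp_all add: inner_add_left scaleR_add_left sum.distrib scaleR_sum_right)
  have BAB: "B r \<bullet> A (B q) = r \<bullet> q" for r q
    by (simp add: B_def linear_sum[OF lin] linear_cmul[OF lin] inner_sum_left inner_sum_right f
        euclidean_inner[of r q] if_distrib[of "\<lambda>x. _ * x"] mult.commute cong: if_cong)
  have injB: "inj B"
    using BAB linB by (metis linear_injective_0 inner_eq_zero_iff inner_zero_left)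
  then have bijB: "bij B" and surjB: "surj B"
    using linear_injective_imp_surjective[OF linB] by (simp_all add: bij_def)
  have [measurable]: "B \<in> borel_measurable borel" "A \<in> borel_measurable borel"
    by (rule borel_measurable_continuous_onI; simp add: lin linB linear_continuous_on linear_conv_bounded_linear[symmetric])+
  obtain C :: real where C: "C > 0" "distr lborel borel B = density lborel (\<lambda>_. ennreal C)"
    using distr_lborel_linear[OF linB bijB] by blast
  define F where "F w s = iexp (s \<bullet> A w) * complex_of_real (exp (- (s \<bullet> A s) / 2))" for w s
  have [measurable]: "F w \<in> borel_measurable borel" for w
    unfolding F_def by measurable
  have F: "integrable lborel (F (B q))" "(\<integral>s. F (B q) s \<partial>lborel) = complex_of_real (sqrt (2 * pi) ^ DIM('a) / C * exp (- (q \<bullet> q) / 2))" for q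
  proof -
    have "integrable lborel (\<lambda>r. F (B q) (B r))"
      unfolding F_def BAB by (rule gaussian_fourier_standard)
    then have "integrable (distr lborel borel B) (F (B q))"
      by (subst integrable_distr_eq) simp_all
    then have "integrable lborel (\<lambda>s. C *\<^sub>R F (B q) s)"
      unfolding C(2) using C(1) by (subst (asm) integrable_density) simp_all
    then have "integrable lborel (\<lambda>s. (1 / C) *\<^sub>R (C *\<^sub>R F (B q) s))"
      by (rule integrable_scaleR_right)
    then show "integrable lborel (F (B q))"
      using C(1) by simp
    have "complex_of_real (sqrt (2 * pi) ^ DIM('a) * exp (- (q \<bullet> q) / 2)) = (\<integral>r. F (B q) (B r) \<partial>lborel)"
      unfolding F_def BAB by (rule gaussian_fourier_standard(2)[symmetric])
    also have "\<dots> = (\<integral>s. F (B q) s \<partial>distr lborel borel B)"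
      by (subst integral_distr) simp_all
    also have "\<dots> = C * (\<integral>s. F (B q) s \<partial>lborel)"
      unfolding C(2) using C(1) by (subst integral_density) (simp_all add: scaleR_conv_of_real)
    finally show "(\<integral>s. F (B q) s \<partial>lborel) = complex_of_real (sqrt (2 * pi) ^ DIM('a) / C * exp (- (q \<bullet> q) / 2))"
      using C(1) by (simp add: field_simps)
  qed
  show thesis
  proof
    show "sqrt (2 * pi) ^ DIM('a) / C > 0"
      using C by simp
    have "integrable lborel (\<lambda>s. norm (F (B 0) s))"
      by (intro integrable_norm F)
    then show "integrable lborel (\<lambda>s. exp (- (s \<bullet> A s) / 2))"
      by (simp add: F_def norm_mult)
    fix w
    obtain q where q: "w = B q"
      using surjB by blast
    show "(\<integral>s. iexp (s \<bullet> A w) * complex_of_real (exp (- (s \<bullet> A s) / 2)) \<partial>lborel) =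
      complex_of_real (sqrt (2 * pi) ^ DIM('a) / C * exp (- (w \<bullet> A w) / 2))"
      using F(2)[of q] unfolding F_def q BAB .
  qed
qed

text \<open>The law of \<open>X\<close> enters only through its characteristic function, so
  \<open>S\<close> may be singular; adding \<open>\<tau>\<^sup>2\<close> times the identity makes
  the form positive definite. As before, the point of evaluation is written as the image of
  \<open>w\<close>, which avoids an inverse.\<close>

lemma expectation_gaussian_kernel:
  fixes X :: "'a \<Rightarrow> 'e::euclidean_space" and S :: "'e \<Rightarrow> 'e"
  assumes "prob_space M" and X [measurable]: "X \<in> borel_measurable M"
    and lin: "linear S" and sym: "\<And>x y. x \<bullet> S y = y \<bullet> S x" and psd: "\<And>x. 0 \<le> x \<bullet> S x" and "\<tau> > 0"
    and char: "\<And>s. (\<integral>\<xi>. iexp (s \<bullet> X \<xi>) \<partial>M) = complex_of_real (exp (- (s \<bullet> S s) / 2))"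
  obtains c where "c > 0"
    and "\<And>w. (\<integral>\<xi>. exp (- (norm (\<tau>\<^sup>2 *\<^sub>R w + S w - X \<xi>))\<^sup>2 / (2 * \<tau>\<^sup>2)) \<partial>M) =
      c * exp (- (w \<bullet> (\<tau>\<^sup>2 *\<^sub>R w + S w)) / 2)"
proof -
  interpret prob_space M by fact
  interpret pair_sigma_finite M "lborel :: 'e measure" ..
  define A where "A w = \<tau>\<^sup>2 *\<^sub>R w + S w" for w
  define g :: "'e \<Rightarrow> real" where "g s = exp (- (s \<bullet> (\<tau>\<^sup>2 *\<^sub>R s)) / 2)" for s
  have [measurable]: "S \<in> borel_measurable borel"
    by (rule borel_measurable_continuous_onI; simp add: lin linear_continuous_on linear_conv_bounded_linear[symmetric])
  have [measurable]: "g \<in> borel_measurable borel"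
    unfolding g_def by measurable
  define G :: "'e \<Rightarrow> 'e" where "G w = \<tau>\<^sup>2 *\<^sub>R w" for w
  have G: "linear G" "x \<bullet> G y = y \<bullet> G x" "x \<noteq> 0 \<Longrightarrow> 0 < x \<bullet> G x" for x y
    using \<open>\<tau> > 0\<close> by (simp_all add: G_def[abs_def] linear_scale_self inner_commute)
  obtain c0 where c0: "c0 > 0" "integrable lborel g"
    "\<And>w. (\<integral>s. iexp (s \<bullet> G w) * complex_of_real (g s) \<partial>lborel) = complex_of_real (c0 * exp (- (w \<bullet> G w) / 2))"
    using gaussian_fourier_pd[OF G] unfolding g_def G_def by blast
  \<comment> \<open>Dividing by \<open>\<tau>\<^sup>2\<close> inverts \<open>G\<close>, so every
    frequency \<open>v\<close> is reached; this exhibits the noise kernel as a Fourier integral of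
    \<open>g\<close>.\<close>
  have c0': "(\<integral>s. iexp (s \<bullet> v) * complex_of_real (g s) \<partial>lborel) = complex_of_real (c0 * exp (- (norm v)\<^sup>2 / (2 * \<tau>\<^sup>2)))" for v
    using c0(3)[of "v /\<^sub>R \<tau>\<^sup>2"] \<open>\<tau> > 0\<close> by (simp add: G_def power2_norm_eq_inner power2_eq_square[of "norm v"] divide_simps mult.commute)
  have linA: "linear A"
    unfolding A_def using lin by (intro linear_compose_add linear_scale_self)
  have symA: "x \<bullet> A y = y \<bullet> A x" for x y
    by (simp add: A_def inner_add_right sym[of x y] inner_commute)
  have pdA: "0 < x \<bullet> A x" if "x \<noteq> 0" for x
    using that psd[of x] \<open>\<tau> > 0\<close> by (simp add: A_def inner_add_right add_pos_nonneg)
  obtain c1 where c1: "c1 > 0"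
    "\<And>w. (\<integral>s. iexp (s \<bullet> A w) * complex_of_real (exp (- (s \<bullet> A s) / 2)) \<partial>lborel) = complex_of_real (c1 * exp (- (w \<bullet> A w) / 2))"
    using gaussian_fourier_pd[OF linA symA pdA] by blast
  have main: "(\<integral>\<xi>. exp (- (norm (A w - X \<xi>))\<^sup>2 / (2 * \<tau>\<^sup>2)) \<partial>M) = c1 / c0 * exp (- (w \<bullet> A w) / 2)" for w
  proof -
    let ?f = "\<lambda>\<xi> s. iexp (s \<bullet> (A w - X \<xi>)) * complex_of_real (g s)"
    have nf: "norm (?f \<xi> s) = g s" for \<xi> s
      by (simp add: norm_mult g_def)
    \<comment> \<open>The modulus of the integrand is \<open>g s\<close>, which is integrable and
      does not depend on \<open>\<xi>\<close>; as \<open>M\<close> is a probability space, this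
      justifies the interchange.\<close>
    have int: "integrable (M \<Otimes>\<^sub>M lborel) (case_prod ?f)"
    proof (rule Fubini_integrable)
      show "case_prod ?f \<in> borel_measurable (M \<Otimes>\<^sub>M lborel)"
        by measurable
      show "integrable M (\<lambda>\<xi>. \<integral>s. norm (case (\<xi>, s) of (\<xi>, s) \<Rightarrow> ?f \<xi> s) \<partial>lborel)"
        unfolding prod.case nf by simp
      show "AE \<xi> in M. integrable lborel (\<lambda>s. case (\<xi>, s) of (\<xi>, s) \<Rightarrow> ?f \<xi> s)"
      proof (intro AE_I2)
        fix \<xi> assume "\<xi> \<in> space M"
        show "integrable lborel (\<lambda>s. case (\<xi>, s) of (\<xi>, s) \<Rightarrow> ?f \<xi> s)"
          by (rule Bochner_Integration.integrable_bound[OF c0(2)]) (simp_all add: norm_mult)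
      qed
    qed
    have "complex_of_real (c0 * (\<integral>\<xi>. exp (- (norm (A w - X \<xi>))\<^sup>2 / (2 * \<tau>\<^sup>2)) \<partial>M)) =
        (\<integral>\<xi>. complex_of_real (c0 * exp (- (norm (A w - X \<xi>))\<^sup>2 / (2 * \<tau>\<^sup>2))) \<partial>M)"
      by simp
    also have "\<dots> = (\<integral>\<xi>. (\<integral>s. ?f \<xi> s \<partial>lborel) \<partial>M)"
      unfolding c0' ..
    also have "\<dots> = (\<integral>s. (\<integral>\<xi>. ?f \<xi> s \<partial>M) \<partial>lborel)"
      by (rule Fubini_integral[OF int, symmetric])
    also have "\<dots> = (\<integral>s. iexp (s \<bullet> A w) * complex_of_real (exp (- (s \<bullet> A s) / 2)) \<partial>lborel)"
    proof (rule Bochner_Integration.integral_cong[OF refl])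
      fix s
      \<comment> \<open>What depends on \<open>\<xi>\<close> is a character at \<open>- s\<close>.
        Its expectation is known, the quadratic form ignores the sign, and the exponents of
        \<open>g\<close> and of the characteristic function of \<open>X\<close> add up to that of
        \<open>A\<close>.\<close>
      have "?f \<xi> s = (iexp (s \<bullet> A w) * complex_of_real (g s)) * iexp ((- s) \<bullet> X \<xi>)" for \<xi>
        by (simp add: inner_diff_right right_diff_distrib flip: exp_add)
      then have "(\<integral>\<xi>. ?f \<xi> s \<partial>M) = (iexp (s \<bullet> A w) * complex_of_real (g s)) * (\<integral>\<xi>. iexp ((- s) \<bullet> X \<xi>) \<partial>M)"
        by (simp only: integral_mult_right_zero)
      also have "\<dots> = iexp (s \<bullet> A w) * complex_of_real (g s * exp (- ((- s) \<bullet> S (- s)) / 2))"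
        unfolding char by simp
      also have "g s * exp (- ((- s) \<bullet> S (- s)) / 2) = exp (- (s \<bullet> A s) / 2)"
        by (simp add: g_def A_def linear_neg[OF lin] inner_add_right add_divide_distrib flip: exp_add)
      finally show "(\<integral>\<xi>. ?f \<xi> s \<partial>M) = iexp (s \<bullet> A w) * complex_of_real (exp (- (s \<bullet> A s) / 2))" .
    qed
    also have "\<dots> = complex_of_real (c1 * exp (- (w \<bullet> A w) / 2))"
      by (rule c1)
    finally show ?thesis
      using c0(1) unfolding of_real_eq_iff by (simp add: field_simps)
  qed
  show thesis
    by (rule that[of "c1 / c0"]) (use c0(1) c1(1) main in \<open>auto simp: A_def\<close>)
qed

section \<open>Gaussian processes\<close>

text \<open>A point mass is the case \<open>d = 0\<close>, so moments and characteristic functions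
  can be taken from the standard normal law without treating degenerate variables
  separately.\<close>

lemma gaussian_rv_standard:
  assumes "gaussian_rv M X"
  obtains m d where "distr M borel X = distr std_normal_distribution borel (\<lambda>u. m + d * u)"
proof -
  interpret std: real_distribution std_normal_distribution
    by (rule real_dist_normal_dist)
  from assms obtain m v where v: "0 \<le> v" and X: "distr M borel X = normal_measure m v"
    unfolding gaussian_rv_def by blast
  have "normal_measure m v = distr std_normal_distribution borel (\<lambda>u. m + sqrt v * u)"
  proof (cases "v = 0")
    case True
    then show ?thesis
      by (simp add: normal_measure_def std.distr_const)
  next
    case False
    with v have "v > 0" by simp
    have "distributed std_normal_distribution lborel (\<lambda>u. u) std_normal_density"
      by (simp add: distributed_def distr_id2 cong: distr_cong)
    from std.normal_density_affine[OF this, of "sqrt v" m] \<open>v > 0\<close>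
    have "distributed std_normal_distribution lborel (\<lambda>u. m + sqrt v * u) (normal_density m (sqrt v))"
      by simp
    then have "distr std_normal_distribution lborel (\<lambda>u. m + sqrt v * u) = density lborel (normal_density m (sqrt v))"
      by (rule distributed_distr_eq_density)
    with False show ?thesis
      by (simp add: normal_measure_def cong: distr_cong)
  qed
  with X that show thesis by metis
qed

text \<open>Everything is transferred along \<open>u \<mapsto> m + d * u\<close> to the standard
  normal law. For mean zero the second moment is the square of \<open>d\<close>, and the expectation
  of \<open>iexp\<close> is the standard normal characteristic function at \<open>d\<close>.\<close>

lemma
  assumes "gaussian_rv M X"
  shows gaussian_rv_integrable: "integrable M X"
    and gaussian_rv_integrable_square: "integrable M (\<lambda>\<xi>. (X \<xi>)\<^sup>2)"
    and gaussian_rv_char: "(\<integral>\<xi>. X \<xi> \<partial>M) = 0 \<Longrightarrow>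
      (\<integral>\<xi>. iexp (X \<xi>) \<partial>M) = complex_of_real (exp (- (\<integral>\<xi>. (X \<xi>)\<^sup>2 \<partial>M) / 2))"
proof -
  interpret std: real_distribution std_normal_distribution
    by (rule real_dist_normal_dist)
  obtain m d where X: "distr M borel X = distr std_normal_distribution borel (\<lambda>u. m + d * u)"
    using gaussian_rv_standard[OF assms] by blast
  have [measurable]: "X \<in> borel_measurable M"
    using assms by (simp add: gaussian_rv_def)
  have transfer: "integrable M (\<lambda>\<xi>. f (X \<xi>)) \<longleftrightarrow> integrable std_normal_distribution (\<lambda>u. f (m + d * u))"
    "(\<integral>\<xi>. f (X \<xi>) \<partial>M) = (\<integral>u. f (m + d * u) \<partial>std_normal_distribution)"
    if [measurable]: "f \<in> borel_measurable borel" for f :: "real \<Rightarrow> 'c::{banach, second_countable_topology}"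
  proof -
    show "integrable M (\<lambda>\<xi>. f (X \<xi>)) \<longleftrightarrow> integrable std_normal_distribution (\<lambda>u. f (m + d * u))"
      using integrable_distr_eq[of X M borel f] integrable_distr_eq[of "\<lambda>u. m + d * u" std_normal_distribution borel f]
      by (simp add: X)
    show "(\<integral>\<xi>. f (X \<xi>) \<partial>M) = (\<integral>u. f (m + d * u) \<partial>std_normal_distribution)"
      using integral_distr[of X M borel f] integral_distr[of "\<lambda>u. m + d * u" std_normal_distribution borel f]
      by (simp add: X)
  qed
  have i1: "integrable std_normal_distribution (\<lambda>u. u)" and i2: "integrable std_normal_distribution (\<lambda>u. u\<^sup>2)"
    using integrable_std_normal_distribution_moment[of 1] integrable_std_normal_distribution_moment[of 2] by simp_all
  have v1: "(\<integral>u. u \<partial>std_normal_distribution) = 0" and v2: "(\<integral>u. u\<^sup>2 \<partial>std_normal_distribution) = 1"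
    using integral_std_normal_distribution_moment_odd[of 1] std_normal_distribution_even_moments(1)[of 1] by simp_all
  have "integrable std_normal_distribution (\<lambda>u. m + d * u)"
    by (intro Bochner_Integration.integrable_add integrable_mult_right i1 std.integrable_const)
  then show "integrable M X"
    using transfer(1)[of "\<lambda>x. x"] by simp
  have "integrable std_normal_distribution (\<lambda>u. m\<^sup>2 + 2 * m * d * u + d\<^sup>2 * u\<^sup>2)"
    by (intro Bochner_Integration.integrable_add integrable_mult_right i1 i2 std.integrable_const)
  moreover have "m\<^sup>2 + 2 * m * d * u + d\<^sup>2 * u\<^sup>2 = (m + d * u)\<^sup>2" for u
    by algebra
  ultimately show "integrable M (\<lambda>\<xi>. (X \<xi>)\<^sup>2)"
    using transfer(1)[of "\<lambda>x. x\<^sup>2"] by simp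
  assume "(\<integral>\<xi>. X \<xi> \<partial>M) = 0"
  moreover have "(\<integral>u. m + d * u \<partial>std_normal_distribution) = (\<integral>u. m \<partial>std_normal_distribution) + (\<integral>u. d * u \<partial>std_normal_distribution)"
    by (intro Bochner_Integration.integral_add integrable_mult_right i1 std.integrable_const)
  moreover have "(\<integral>u. m \<partial>std_normal_distribution) = m"
    unfolding lebesgue_integral_const std.prob_space by simp
  moreover have "(\<integral>u. d * u \<partial>std_normal_distribution) = 0"
    by (simp only: integral_mult_right_zero v1)
  moreover have "(\<integral>\<xi>. X \<xi> \<partial>M) = (\<integral>u. m + d * u \<partial>std_normal_distribution)"
    by (rule transfer(2)[of "\<lambda>x. x"]) simp
  ultimately have m: "m = 0"
    by linarith
  have sq: "(\<integral>\<xi>. (X \<xi>)\<^sup>2 \<partial>M) = d\<^sup>2"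
    using transfer(2)[of "\<lambda>x. x\<^sup>2"] by (simp add: m power_mult_distrib v2)
  have "(\<integral>\<xi>. iexp (X \<xi>) \<partial>M) = char std_normal_distribution d"
    using transfer(2)[of iexp] by (simp add: m char_def)
  then show "(\<integral>\<xi>. iexp (X \<xi>) \<partial>M) = complex_of_real (exp (- (\<integral>\<xi>. (X \<xi>)\<^sup>2 \<partial>M) / 2))"
    by (simp add: char_std_normal_distribution sq)
qed

text \<open>The points \<open>t i\<close> may coincide, whereas the definition of a Gaussian process
  sums over a set of points; coefficients that belong to the same point are therefore added
  first.\<close>

lemma gaussian_process_linear_combination:
  assumes "gaussian_process M T m \<kappa> \<omega>" "finite I" "\<And>i. i \<in> I \<Longrightarrow> t i \<in> T"
  shows "gaussian_rv M (\<lambda>\<xi>. \<Sum>i\<in>I. a i \<bullet> \<omega> (t i) \<xi>)"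
proof -
  have "(\<Sum>i\<in>I. a i \<bullet> \<omega> (t i) \<xi>) = (\<Sum>u\<in>t ` I. (\<Sum>i | i \<in> I \<and> t i = u. a i) \<bullet> \<omega> u \<xi>)" for \<xi>
    by (subst sum.image_gen[OF assms(2), of _ t]) (simp add: inner_sum_left)
  moreover have "gaussian_rv M (\<lambda>\<xi>. \<Sum>u\<in>t ` I. (\<Sum>i | i \<in> I \<and> t i = u. a i) \<bullet> \<omega> u \<xi>)"
  proof -
    have *: "finite S \<Longrightarrow> S \<subseteq> T \<Longrightarrow> gaussian_rv M (\<lambda>\<xi>. \<Sum>u\<in>S. c u \<bullet> \<omega> u \<xi>)" for S c
      using assms(1) unfolding gaussian_process_def by simp
    show ?thesis
      by (rule *) (use assms(2,3) in auto)
  qed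
  ultimately show ?thesis by simp
qed

text \<open>Products are integrable since they are dominated by a sum of squares. This allows the
  covariance to be expanded in coordinates, where isotropy leaves only the diagonal terms and hence
  the factor \<open>a \<bullet> b\<close>.\<close>

lemma
  fixes a b :: "real^'m"
  assumes gp: "gaussian_process M T (\<lambda>_. 0) (isotropic_kernel k) \<omega>" and t: "t \<in> T" "t' \<in> T"
  shows gaussian_process_mean: "(\<integral>\<xi>. a \<bullet> \<omega> t \<xi> \<partial>M) = 0"
    and gaussian_process_integrable: "integrable M (\<lambda>\<xi>. a \<bullet> \<omega> t \<xi>)"
    and gaussian_process_integrable_mult: "integrable M (\<lambda>\<xi>. (a \<bullet> \<omega> t \<xi>) * (b \<bullet> \<omega> t' \<xi>))"
    and gaussian_process_covariance: "(\<integral>\<xi>. (a \<bullet> \<omega> t \<xi>) * (b \<bullet> \<omega> t' \<xi>) \<partial>M) = (a \<bullet> b) * k t t'"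
proof -
  have g: "gaussian_rv M (\<lambda>\<xi>. a \<bullet> \<omega> t \<xi>)" if "t \<in> T" for a t
    using gaussian_process_linear_combination[OF gp, of "{()}" "\<lambda>_. t" "\<lambda>_. a"] that by simp
  have i: "integrable M (\<lambda>\<xi>. a \<bullet> \<omega> t \<xi>)" if "t \<in> T" for a t
    by (intro gaussian_rv_integrable g that)
  have im: "integrable M (\<lambda>\<xi>. (a \<bullet> \<omega> t \<xi>) * (b \<bullet> \<omega> t' \<xi>))" if "t \<in> T" "t' \<in> T" for a b t t'
  proof (rule Bochner_Integration.integrable_bound)
    show "integrable M (\<lambda>\<xi>. (a \<bullet> \<omega> t \<xi>)\<^sup>2 + (b \<bullet> \<omega> t' \<xi>)\<^sup>2)"
      by (intro Bochner_Integration.integrable_add gaussian_rv_integrable_square g that)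
    show "(\<lambda>\<xi>. (a \<bullet> \<omega> t \<xi>) * (b \<bullet> \<omega> t' \<xi>)) \<in> borel_measurable M"
      using i[OF that(1), of a] i[OF that(2), of b] by measurable
    have "\<bar>u * v\<bar> \<le> u\<^sup>2 + v\<^sup>2" for u v :: real
      using sum_squares_bound[of "\<bar>u\<bar>" "\<bar>v\<bar>"] abs_ge_zero[of "u * v"]
      unfolding abs_mult power2_abs by linarith
    then show "AE \<xi> in M. norm ((a \<bullet> \<omega> t \<xi>) * (b \<bullet> \<omega> t' \<xi>)) \<le> norm ((a \<bullet> \<omega> t \<xi>)\<^sup>2 + (b \<bullet> \<omega> t' \<xi>)\<^sup>2)"
      by simp
  qed
  show "integrable M (\<lambda>\<xi>. a \<bullet> \<omega> t \<xi>)" "integrable M (\<lambda>\<xi>. (a \<bullet> \<omega> t \<xi>) * (b \<bullet> \<omega> t' \<xi>))"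
    using i im t by auto
  have ax: "axis s 1 \<bullet> w = w $ s" for s and w :: "real^'m"
    by (simp add: inner_axis')
  have ic: "integrable M (\<lambda>\<xi>. \<omega> u \<xi> $ s)" if "u \<in> T" for u s
    using i[OF that, of "axis s 1"] by (simp add: ax)
  have imc: "integrable M (\<lambda>\<xi>. \<omega> t \<xi> $ s * \<omega> t' \<xi> $ r)" for s r
    using im[OF t, of "axis s 1" "axis r 1"] by (simp add: ax)
  have "(\<integral>\<xi>. a \<bullet> \<omega> t \<xi> \<partial>M) = (\<Sum>s\<in>UNIV. a $ s * (\<integral>\<xi>. \<omega> t \<xi> $ s \<partial>M))"
    unfolding inner_vec_def using ic[OF t(1)] by simp
  also have "\<dots> = 0"
    using gp t unfolding gaussian_process_def by simp
  finally show "(\<integral>\<xi>. a \<bullet> \<omega> t \<xi> \<partial>M) = 0" .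
  have "(\<integral>\<xi>. (a \<bullet> \<omega> t \<xi>) * (b \<bullet> \<omega> t' \<xi>) \<partial>M) =
      (\<integral>\<xi>. (\<Sum>s\<in>UNIV. \<Sum>r\<in>UNIV. a $ s * b $ r * (\<omega> t \<xi> $ s * \<omega> t' \<xi> $ r)) \<partial>M)"
    unfolding inner_vec_def sum_product by (simp add: ac_simps)
  also have "\<dots> = (\<Sum>s\<in>UNIV. \<Sum>r\<in>UNIV. a $ s * b $ r * (\<integral>\<xi>. \<omega> t \<xi> $ s * \<omega> t' \<xi> $ r \<partial>M))"
    using imc by simp
  also have "\<dots> = (\<Sum>s\<in>UNIV. \<Sum>r\<in>UNIV. a $ s * b $ r * (k t t' * (if s = r then 1 else 0)))"
    using gp t unfolding gaussian_process_def by (simp add: isotropic_kernel_def mat_def)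
  also have "\<dots> = (a \<bullet> b) * k t t'"
    by (simp add: inner_vec_def sum_distrib_right if_distrib cong: if_cong)
  finally show "(\<integral>\<xi>. (a \<bullet> \<omega> t \<xi>) * (b \<bullet> \<omega> t' \<xi>) \<partial>M) = (a \<bullet> b) * k t t'" .
qed

text \<open>The sum is Gaussian and centred, so its variance determines its characteristic function.
  The variance identity also shows that the double sum is nonnegative.\<close>

lemma
  fixes a :: "'i \<Rightarrow> real^'m"
  assumes gp: "gaussian_process M T (\<lambda>_. 0) (isotropic_kernel k) \<omega>" and I: "finite I" and t: "\<And>i. i \<in> I \<Longrightarrow> t i \<in> T"
  shows gaussian_process_variance:
      "(\<integral>\<xi>. (\<Sum>i\<in>I. a i \<bullet> \<omega> (t i) \<xi>)\<^sup>2 \<partial>M) = (\<Sum>i\<in>I. \<Sum>j\<in>I. (a i \<bullet> a j) * k (t i) (t j))"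
    and gaussian_process_char:
      "(\<integral>\<xi>. iexp (\<Sum>i\<in>I. a i \<bullet> \<omega> (t i) \<xi>) \<partial>M) =
        complex_of_real (exp (- (\<Sum>i\<in>I. \<Sum>j\<in>I. (a i \<bullet> a j) * k (t i) (t j)) / 2))"
proof -
  have "(\<integral>\<xi>. (\<Sum>i\<in>I. a i \<bullet> \<omega> (t i) \<xi>)\<^sup>2 \<partial>M) =
      (\<integral>\<xi>. (\<Sum>i\<in>I. \<Sum>j\<in>I. (a i \<bullet> \<omega> (t i) \<xi>) * (a j \<bullet> \<omega> (t j) \<xi>)) \<partial>M)"
    by (simp add: power2_eq_square sum_product)
  also have "\<dots> = (\<Sum>i\<in>I. \<Sum>j\<in>I. (\<integral>\<xi>. (a i \<bullet> \<omega> (t i) \<xi>) * (a j \<bullet> \<omega> (t j) \<xi>) \<partial>M))"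
    by (subst Bochner_Integration.integral_sum)
      (auto intro!: sum.cong Bochner_Integration.integral_sum Bochner_Integration.integrable_sum gaussian_process_integrable_mult[OF gp] t)
  also have "\<dots> = (\<Sum>i\<in>I. \<Sum>j\<in>I. (a i \<bullet> a j) * k (t i) (t j))"
    by (intro sum.cong refl gaussian_process_covariance[OF gp] t)
  finally show var: "(\<integral>\<xi>. (\<Sum>i\<in>I. a i \<bullet> \<omega> (t i) \<xi>)\<^sup>2 \<partial>M) = (\<Sum>i\<in>I. \<Sum>j\<in>I. (a i \<bullet> a j) * k (t i) (t j))" .
  have "(\<integral>\<xi>. (\<Sum>i\<in>I. a i \<bullet> \<omega> (t i) \<xi>) \<partial>M) = 0"
    by (subst Bochner_Integration.integral_sum)
      (auto intro!: sum.neutral gaussian_process_integrable[OF gp] gaussian_process_mean[OF gp] t)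
  from gaussian_rv_char[OF gaussian_process_linear_combination[OF gp I t] this]
  show "(\<integral>\<xi>. iexp (\<Sum>i\<in>I. a i \<bullet> \<omega> (t i) \<xi>) \<partial>M) =
        complex_of_real (exp (- (\<Sum>i\<in>I. \<Sum>j\<in>I. (a i \<bullet> a j) * k (t i) (t j)) / 2))"
    unfolding var by simp
qed

section \<open>Labels of a generalized linear model\<close>

lemma pmf_binary_zero:
  assumes "binary_likelihood p" "b \<notin> {0, 1}"
  shows "pmf (p z) b = 0"
proof -
  have "set_pmf (p z) \<subseteq> {0, 1}"
    using assms(1) unfolding binary_likelihood_def by blast
  with assms(2) have "b \<notin> set_pmf (p z)"
    by blast
  then show ?thesis
    by (simp add: set_pmf_iff)
qed

text \<open>Makes the bind in \<open>glm_observation\<close> computable. As the labels lie in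
  \<open>{0, 1}\<close>, the mass of a set is a sum of two measurable functions of
  \<open>z\<close>.\<close>

lemma measurable_binary_likelihood_kernel:
  assumes "binary_likelihood p"
  shows "(\<lambda>z. distr (measure_pmf (p z)) (borel \<Otimes>\<^sub>M count_space UNIV) (\<lambda>b. (z, b))) \<in>
    borel \<rightarrow>\<^sub>M subprob_algebra (borel \<Otimes>\<^sub>M count_space UNIV)"
proof (rule measurable_subprob_algebra)
  fix z :: real assume "z \<in> space borel"
  have [measurable]: "(\<lambda>b. (z, b)) \<in> measure_pmf (p z) \<rightarrow>\<^sub>M borel \<Otimes>\<^sub>M count_space UNIV"
    by measurable
  show "subprob_space (distr (measure_pmf (p z)) (borel \<Otimes>\<^sub>M count_space UNIV) (\<lambda>b. (z, b)))"
    by (intro prob_space_imp_subprob_space prob_space.prob_space_distr measure_pmf.prob_space_axioms) measurable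
next
  fix A :: "(real \<times> nat) set" assume A [measurable]: "A \<in> sets (borel \<Otimes>\<^sub>M count_space UNIV)"
  have [measurable]: "(\<lambda>z. pmf (p z) b) \<in> borel_measurable borel" for b
    using assms by (simp add: binary_likelihood_def)
  have eq: "emeasure (distr (measure_pmf (p z)) (borel \<Otimes>\<^sub>M count_space UNIV) (\<lambda>b. (z, b))) A =
      (\<Sum>b\<in>{0, 1}. ennreal (pmf (p z) b) * indicator A (z, b))" for z
  proof -
    have "emeasure (distr (measure_pmf (p z)) (borel \<Otimes>\<^sub>M count_space UNIV) (\<lambda>b. (z, b))) A =
        (\<integral>\<^sup>+b. indicator A (z, b) \<partial>measure_pmf (p z))"
      by (subst nn_integral_indicator[symmetric], simp add: A, subst nn_integral_distr) (simp_all add: space_pair_measure)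
    also have "\<dots> = (\<integral>\<^sup>+b. ennreal (pmf (p z) b) * indicator A (z, b) \<partial>count_space UNIV)"
      by (rule nn_integral_measure_pmf)
    also have "\<dots> = (\<Sum>b\<in>{0, 1}. ennreal (pmf (p z) b) * indicator A (z, b))"
      by (rule nn_integral_count_space') (use pmf_binary_zero[OF assms] in auto)
    finally show ?thesis .
  qed
  show "(\<lambda>z. emeasure (distr (measure_pmf (p z)) (borel \<Otimes>\<^sub>M count_space UNIV) (\<lambda>b. (z, b))) A) \<in> borel_measurable borel"
    unfolding eq by measurable
qed simp

lemma emeasure_glm_observation_label:
  assumes p: "binary_likelihood p" and "\<tau> > 0"
  shows "emeasure (glm_observation p \<tau> x w) (UNIV \<times> {b}) =
    (\<integral>\<^sup>+z. ennreal (pmf (p z) b) * ennreal (normal_density (w \<bullet> x) \<tau> z) \<partial>lborel)"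
proof -
  have [measurable]: "(\<lambda>z. pmf (p z) b) \<in> borel_measurable borel"
    using p by (simp add: binary_likelihood_def)
  have N: "normal_measure (w \<bullet> x) (\<tau>\<^sup>2) = density lborel (\<lambda>z. ennreal (normal_density (w \<bullet> x) \<tau> z))"
    using \<open>\<tau> > 0\<close> by (simp add: normal_measure_def)
  have "emeasure (glm_observation p \<tau> x w) (UNIV \<times> {b}) =
    (\<integral>\<^sup>+z. emeasure (distr (measure_pmf (p z)) (borel \<Otimes>\<^sub>M count_space UNIV) (\<lambda>b. (z, b))) (UNIV \<times> {b}) \<partial>normal_measure (w \<bullet> x) (\<tau>\<^sup>2))"
    unfolding glm_observation_def
    using measurable_binary_likelihood_kernel[OF p]
    by (intro emeasure_bind) (auto simp: N space_pair_measure intro!: pair_measureI cong: measurable_cong_sets)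
  also have "\<dots> = (\<integral>\<^sup>+z. ennreal (pmf (p z) b) \<partial>normal_measure (w \<bullet> x) (\<tau>\<^sup>2))"
  proof (rule nn_integral_cong)
    fix z
    have "emeasure (distr (measure_pmf (p z)) (borel \<Otimes>\<^sub>M count_space UNIV) (\<lambda>b. (z, b))) (UNIV \<times> {b}) =
        emeasure (measure_pmf (p z)) ((\<lambda>b. (z, b)) -` (UNIV \<times> {b}) \<inter> space (measure_pmf (p z)))"
      by (rule emeasure_distr) (auto simp: space_pair_measure intro!: pair_measureI)
    also have "(\<lambda>b. (z, b)) -` (UNIV \<times> {b}) \<inter> space (measure_pmf (p z)) = {b}"
      by auto
    finally show "emeasure (distr (measure_pmf (p z)) (borel \<Otimes>\<^sub>M count_space UNIV) (\<lambda>b. (z, b))) (UNIV \<times> {b}) = ennreal (pmf (p z) b)"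
      by (simp add: emeasure_pmf_single)
  qed
  also have "\<dots> = (\<integral>\<^sup>+z. ennreal (pmf (p z) b) * ennreal (normal_density (w \<bullet> x) \<tau> z) \<partial>lborel)"
    unfolding N by (subst nn_integral_density) (simp_all add: mult.commute)
  finally show ?thesis .
qed

text \<open>\<open>measure\<close> would be 0 on a set of infinite mass. This is excluded because
  the integral is at most the total mass 1 of the normal density.\<close>

lemma measure_glm_observation_label:
  assumes p: "binary_likelihood p" and "\<tau> > 0"
  shows "ennreal (measure (glm_observation p \<tau> x w) (UNIV \<times> {b})) =
    (\<integral>\<^sup>+z. ennreal (pmf (p z) b) * ennreal (normal_density (w \<bullet> x) \<tau> z) \<partial>lborel)"
proof -
  have "(\<integral>\<^sup>+z. ennreal (pmf (p z) b) * ennreal (normal_density (w \<bullet> x) \<tau> z) \<partial>lborel) \<le>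
      (\<integral>\<^sup>+z. ennreal (normal_density (w \<bullet> x) \<tau> z) \<partial>lborel)"
    by (intro nn_integral_mono) (simp add: pmf_le_1 mult_left_le_one_le flip: ennreal_mult)
  also have "\<dots> = 1"
    using \<open>\<tau> > 0\<close> by (simp add: nn_integral_eq_integral)
  finally have "emeasure (glm_observation p \<tau> x w) (UNIV \<times> {b}) \<noteq> \<top>"
    unfolding emeasure_glm_observation_label[OF assms] by (rule neq_top_trans[OF ennreal_one_neq_top])
  then show ?thesis
    by (simp add: emeasure_eq_ennreal_measure[symmetric] emeasure_glm_observation_label[OF assms])
qed

section \<open>Conditioning on the process\<close>

lemma process_algebra_subalgebra:
  assumes "\<And>t. t \<in> T \<Longrightarrow> \<omega> t \<in> borel_measurable M"
  shows "subalgebra M (process_algebra M T \<omega>)"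
proof -
  have "(\<lambda>\<xi>. \<lambda>t\<in>T. \<omega> t \<xi>) \<in> M \<rightarrow>\<^sub>M (\<Pi>\<^sub>M t\<in>T. borel)"
    using assms by (rule measurable_restrict)
  from measurable_sets[OF this] measurable_space[OF this]
  show ?thesis
    unfolding subalgebra_def process_algebra_def by (auto simp: sets_vimage_algebra2)
qed

text \<open>The rectangles \<open>UNIV \<times> {y i}\<close> leave the latent variables free, and
  the expectation of a conditional probability is the probability itself. A nonnegative integral on
  the right can be rewritten almost everywhere without a separate integrability argument.\<close>

lemma prob_labels:
  assumes "prob_space M"
    and \<omega>: "\<And>t. t \<in> T \<Longrightarrow> \<omega> t \<in> borel_measurable M"
    and drawn: "drawn_independently_given M T \<omega> obs x t xs ts Z Y Zs Ys"
  shows "ennreal (\<P>(\<xi> in M. (\<forall>i. Y i \<xi> = y i) \<and> Ys \<xi> = b)) =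
    (\<integral>\<^sup>+\<xi>. ennreal ((\<Prod>i\<in>UNIV. measure (obs (x i) (\<omega> (t i) \<xi>)) (UNIV \<times> {y i})) * measure (obs xs (\<omega> ts \<xi>)) (UNIV \<times> {b})) \<partial>M)"
proof -
  interpret prob_space M by fact
  interpret finite_measure_subalgebra M "process_algebra M T \<omega>"
    by standard (rule process_algebra_subalgebra[OF \<omega>])
  from drawn have Y: "Y i \<in> M \<rightarrow>\<^sub>M count_space UNIV" and Ys: "Ys \<in> M \<rightarrow>\<^sub>M count_space UNIV" for i
    unfolding drawn_independently_given_def by auto
  note [measurable] = Y Ys
  define E where "E = {\<xi> \<in> space M. (\<forall>i. Y i \<xi> = y i) \<and> Ys \<xi> = b}"
  have E [measurable]: "E \<in> sets M"
    unfolding E_def by measurable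
  have S: "UNIV \<times> {c} \<in> sets (borel \<Otimes>\<^sub>M count_space UNIV)" for c :: nat
    by (intro pair_measureI) auto
  let ?g = "\<lambda>\<xi>. (\<Prod>i\<in>UNIV. measure (obs (x i) (\<omega> (t i) \<xi>)) (UNIV \<times> {y i})) * measure (obs xs (\<omega> ts \<xi>)) (UNIV \<times> {b})"
  have ae: "AE \<xi> in M. real_cond_exp M (process_algebra M T \<omega>) (indicator E) \<xi> = ?g \<xi>"
  proof -
    have "AE \<xi> in M. real_cond_exp M (process_algebra M T \<omega>)
        (indicator {\<xi> \<in> space M. (\<forall>i. (Z i \<xi>, Y i \<xi>) \<in> UNIV \<times> {y i}) \<and> (Zs \<xi>, Ys \<xi>) \<in> UNIV \<times> {b}}) \<xi> = ?g \<xi>"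
      using drawn[unfolded drawn_independently_given_def, THEN conjunct2, THEN conjunct2, THEN conjunct2,
        rule_format, of "\<lambda>i. UNIV \<times> {y i}" "UNIV \<times> {b}"] S by simp
    then show ?thesis
      by (simp add: E_def)
  qed
  have int: "integrable M (indicator E :: _ \<Rightarrow> real)"
    by (simp add: emeasure_eq_measure)
  have nn: "AE \<xi> in M. 0 \<le> real_cond_exp M (process_algebra M T \<omega>) (indicator E) \<xi>"
    using ae by eventually_elim (simp add: prod_nonneg)
  have "ennreal (measure M E) = ennreal (\<integral>\<xi>. real_cond_exp M (process_algebra M T \<omega>) (indicator E) \<xi> \<partial>M)"
    by (simp add: real_cond_exp_int(2)[OF int])
  also have "\<dots> = (\<integral>\<^sup>+\<xi>. ennreal (real_cond_exp M (process_algebra M T \<omega>) (indicator E) \<xi>) \<partial>M)"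
    by (rule nn_integral_eq_integral[OF real_cond_exp_int(1)[OF int] nn, symmetric])
  also have "\<dots> = (\<integral>\<^sup>+\<xi>. ennreal (?g \<xi>) \<partial>M)"
    by (rule nn_integral_cong_AE) (use ae in eventually_elim, simp)
  finally show ?thesis
    unfolding E_def .
qed

section \<open>The smoothed density of the predictors\<close>

text \<open>The product formula over \<open>Basis\<close>, reindexed along the bijection from
  \<open>'n\<close> to the axis vectors.\<close>

lemma nn_integral_lborel_vec_prod:
  fixes f :: "'n::finite \<Rightarrow> real \<Rightarrow> ennreal"
  assumes [measurable]: "\<And>i. f i \<in> borel_measurable borel"
  shows "(\<integral>\<^sup>+z. (\<Prod>i\<in>UNIV. f i (z $ i)) \<partial>(lborel :: (real^'n) measure)) = (\<Prod>i\<in>UNIV. (\<integral>\<^sup>+u. f i u \<partial>lborel))"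
proof -
  define e :: "'n \<Rightarrow> real^'n" where "e i = axis i 1" for i
  have inj: "inj e"
    by (simp add: inj_def e_def axis_eq_axis)
  have Basis: "(Basis :: (real^'n) set) = range e"
    by (auto simp: Basis_vec_def e_def)
  have "(\<integral>\<^sup>+z. (\<Prod>b\<in>(Basis :: (real^'n) set). f (inv e b) (z \<bullet> b)) \<partial>lborel) = (\<Prod>b\<in>(Basis :: (real^'n) set). (\<integral>\<^sup>+u. f (inv e b) u \<partial>lborel))"
    by (rule nn_integral_lborel_prod) simp_all
  moreover have "inv e (axis i 1) = i" for i
    using inv_f_f[OF inj, of i] by (simp add: e_def)
  ultimately show ?thesis
    unfolding Basis prod.reindex[OF inj] by (simp add: e_def inner_axis)
qed

section \<open>Positive definite and bordered matrices\<close>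

text \<open>With a system orthonormal for the form of \<open>Q\<close> as the rows of
  \<open>R\<close>, the product of \<open>R\<close>, \<open>Q\<close> and the transpose of
  \<open>R\<close> is the identity, so a square times \<open>det Q\<close> equals 1.\<close>

lemma det_pos:
  fixes Q :: "real^'n^'n"
  assumes sym: "transpose Q = Q" and pd: "\<And>x. x \<noteq> 0 \<Longrightarrow> 0 < x \<bullet> (Q *v x)"
  shows "0 < det Q"
proof -
  have "x \<bullet> (Q *v y) = y \<bullet> (Q *v x)" for x y
    by (metis dot_lmul_matrix inner_commute sym transpose_matrix_vector)
  then obtain f :: "real^'n \<Rightarrow> real^'n" where f: "\<And>b c. b \<in> Basis \<Longrightarrow> c \<in> Basis \<Longrightarrow> f b \<bullet> (Q *v f c) = (if b = c then 1 else 0)"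
    using orthonormal_system_exists[OF matrix_vector_mul_linear, of Q] pd by blast
  define R :: "real^'n^'n" where "R = (\<chi> i. f (axis i 1))"
  have "(R ** Q ** transpose R) $ i $ j = (mat 1 :: real^'n^'n) $ i $ j" for i j
  proof -
    have "(R ** Q ** transpose R) $ i $ j = (R $ i) \<bullet> (Q *v (R $ j))"
      by (subst matrix_mul_assoc[symmetric])
        (simp add: matrix_matrix_mult_def inner_vec_def matrix_vector_mult_def transpose_def)
    also have "\<dots> = (mat 1 :: real^'n^'n) $ i $ j"
      by (simp add: R_def f axis_in_Basis_iff mat_def axis_eq_axis)
    finally show ?thesis .
  qed
  then have "R ** Q ** transpose R = mat 1"
    by (simp add: vec_eq_iff)
  then have "det R * det Q * det R = 1"
    by (metis det_I det_mul det_transpose)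
  then have "(det R)\<^sup>2 * det Q = 1"
    by (simp add: power2_eq_square mult_ac)
  then show ?thesis
    by (metis zero_le_power2 zero_less_mult_pos zero_less_one mult_zero_left order_le_less)
qed

text \<open>Block elimination for \<open>A (s, r) = (z, u)\<close>, where \<open>A\<close> has the blocks \<open>Q\<close>, \<open>q\<close>, \<open>q\<^sup>T\<close>, \<open>c\<close>
  and \<open>v\<close> is the Schur complement of \<open>Q\<close>; the left-hand side of the last equation is
  \<open>(z, u) \<bullet> A\<^sup>-\<^sup>1 (z, u)\<close>.\<close>

lemma bordered_solution:
  fixes Q R :: "real^'n^'n" and q z :: "real^'n"
  assumes QR: "Q ** R = mat 1" and sym: "transpose R = R"
    and v: "v = c - q \<bullet> (R *v q)" "v \<noteq> 0"
    and r: "r = (u - q \<bullet> (R *v z)) / v" and s: "s = R *v (z - r *\<^sub>R q)"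
  shows "Q *v s + r *\<^sub>R q = z" and "q \<bullet> s + r * c = u"
    and "s \<bullet> z + r * u = z \<bullet> (R *v z) + (u - q \<bullet> (R *v z))\<^sup>2 / v"
proof -
  have rv: "r * v = u - q \<bullet> (R *v z)"
    using r v(2) by simp
  have s': "s = R *v z - r *\<^sub>R (R *v q)"
    unfolding s by (simp add: matrix_vector_mult_diff_distrib matrix_vector_mult_scaleR)
  have "Q *v s = z - r *\<^sub>R q"
    unfolding s by (simp add: matrix_vector_mul_assoc QR)
  then show "Q *v s + r *\<^sub>R q = z"
    by simp
  have "q \<bullet> s + r * c = q \<bullet> (R *v z) + r * v"
    by (simp add: s' v(1) inner_diff_right algebra_simps)
  then show "q \<bullet> s + r * c = u"
    using rv by simp
  have swap: "(R *v q) \<bullet> z = q \<bullet> (R *v z)"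
    by (metis dot_lmul_matrix sym transpose_matrix_vector)
  have "s \<bullet> z + r * u = z \<bullet> (R *v z) + r * (u - q \<bullet> (R *v z))"
    by (simp add: s' inner_diff_left swap inner_commute[of "R *v z" z] algebra_simps)
  also have "r * (u - q \<bullet> (R *v z)) = (u - q \<bullet> (R *v z))\<^sup>2 / v"
    unfolding r by (simp add: power2_eq_square)
  finally show "s \<bullet> z + r * u = z \<bullet> (R *v z) + (u - q \<bullet> (R *v z))\<^sup>2 / v" .
qed

lemma sum_UNIV_option:
  "(\<Sum>i\<in>(UNIV :: 'n::finite option set). f i) = f None + (\<Sum>i\<in>UNIV. f (Some i))"
  by (simp add: UNIV_option_conv sum.reindex)

text \<open>\<open>expectation_gaussian_kernel\<close> is applied to the joint vector of training
  and test predictors. By \<open>bordered_solution\<close> the resulting exponent splits into the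
  quadratic form of the inverse of \<open>Q\<close> and a squared deviation divided by
  \<open>v\<close>, that is, into a marginal density of \<open>z\<close> and a conditional density
  of \<open>u\<close>.\<close>

lemma gaussian_process_smoothed_density:
  fixes x :: "'n::finite \<Rightarrow> real^'m" and Q :: "real^'n^'n"
  assumes "prob_space M" and k: "psd_kernel T k"
    and gp: "gaussian_process M T (\<lambda>_. 0) (isotropic_kernel k) \<omega>"
    and t: "\<And>i. t i \<in> T" and ts: "ts \<in> T" and "\<tau> > 0"
    and Q: "Q = (\<chi> i j. (x i \<bullet> x j) * k (t i) (t j)) + \<tau>\<^sup>2 *\<^sub>R mat 1"
    and q: "q = (\<chi> i. (x i \<bullet> xs) * k (t i) ts)"
    and v: "v = (xs \<bullet> xs) * k ts ts - q \<bullet> (matrix_inv Q *v q) + \<tau>\<^sup>2"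
  obtains c where "c > 0"
    and "\<And>z u. (\<integral>\<xi>. exp (- (norm ((z, u) - (\<chi> i. \<omega> (t i) \<xi> \<bullet> x i, \<omega> ts \<xi> \<bullet> xs)))\<^sup>2 / (2 * \<tau>\<^sup>2)) \<partial>M) =
      c * (normal_density (q \<bullet> (matrix_inv Q *v z)) (sqrt v) u * mvn_density 0 Q z)"
proof -
  define K :: "real^'n^'n" where "K = (\<chi> i j. (x i \<bullet> x j) * k (t i) (t j))"
  define \<kappa> where "\<kappa> = (xs \<bullet> xs) * k ts ts"
  \<comment> \<open>The covariance operator of the joint predictor vector \<open>X\<close>, in block
    form.\<close>
  define S where "S w = (K *v fst w + snd w *\<^sub>R q, q \<bullet> fst w + snd w * \<kappa>)" for w :: "(real^'n) \<times> real"
  define X where "X \<xi> = (\<chi> i. \<omega> (t i) \<xi> \<bullet> x i, \<omega> ts \<xi> \<bullet> xs)" for \<xi>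
  have k_sym: "k a b = k b a" if "a \<in> T" "b \<in> T" for a b
    using k that unfolding psd_kernel_def by blast
  have K_sym: "a \<bullet> (K *v b) = b \<bullet> (K *v a)" for a b
  proof -
    have "transpose K = K"
      by (simp add: K_def transpose_def vec_eq_iff inner_commute k_sym t)
    then show ?thesis
      by (metis dot_lmul_matrix inner_commute transpose_matrix_vector)
  qed
  have linS: "linear S"
    by (intro linearI) (simp_all add: S_def matrix_vector_right_distrib matrix_vector_mult_scaleR algebra_simps inner_add_right)
  have symS: "a \<bullet> S b = b \<bullet> S a" for a b
    by (cases a; cases b) (simp add: S_def inner_add_right inner_commute[of q] algebra_simps, rule K_sym)
  \<comment> \<open>Indexing by \<open>'n option\<close>, with \<open>None\<close> for the test
    point, makes all points one finite family; the coefficients are chosen so that the linear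
    combination of the process is \<open>s \<bullet> X \<xi>\<close>.\<close>
  define a where "a s i = (case i of None \<Rightarrow> snd s *\<^sub>R xs | Some j \<Rightarrow> (fst s $ j) *\<^sub>R x j)" for s :: "(real^'n) \<times> real" and i
  define t' where "t' = case_option ts t"
  have t': "t' i \<in> T" for i
    by (simp add: t'_def t ts split: option.split)
  have aX: "(\<Sum>i\<in>UNIV. a s i \<bullet> \<omega> (t' i) \<xi>) = s \<bullet> X \<xi>" for s \<xi>
    by (simp add: inner_prod_def sum_UNIV_option a_def t'_def X_def inner_vec_def[of "fst s"] inner_commute)
  have aS: "(\<Sum>i\<in>UNIV. \<Sum>j\<in>UNIV. (a s i \<bullet> a s j) * k (t' i) (t' j)) = s \<bullet> S s" for s
  proof -
    have "fst s \<bullet> (K *v fst s) = (\<Sum>i\<in>UNIV. \<Sum>j\<in>UNIV. fst s $ i * fst s $ j * (x i \<bullet> x j) * k (t i) (t j))"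
      by (simp add: inner_vec_def[of "fst s"] matrix_vector_mult_def K_def sum_distrib_left mult_ac)
    moreover have "q \<bullet> fst s = (\<Sum>i\<in>UNIV. fst s $ i * (x i \<bullet> xs) * k (t i) ts)"
      by (subst inner_vec_def) (simp add: q mult_ac)
    moreover have "(a s None \<bullet> a s None) * k (t' None) (t' None) = snd s * (snd s * \<kappa>)"
      and "(a s None \<bullet> a s (Some j)) * k (t' None) (t' (Some j)) = snd s * (fst s $ j * (x j \<bullet> xs) * k (t j) ts)"
      and "(a s (Some j) \<bullet> a s None) * k (t' (Some j)) (t' None) = snd s * (fst s $ j * (x j \<bullet> xs) * k (t j) ts)"
      and "(a s (Some i) \<bullet> a s (Some j)) * k (t' (Some i)) (t' (Some j)) = fst s $ i * fst s $ j * (x i \<bullet> x j) * k (t i) (t j)" for i j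
      by (simp_all add: a_def t'_def \<kappa>_def k_sym[OF ts t] inner_commute[of xs "x j"])
    moreover have "s \<bullet> S s = fst s \<bullet> (K *v fst s) + 2 * (snd s * (q \<bullet> fst s)) + snd s * (snd s * \<kappa>)"
      by (simp add: S_def inner_prod_def inner_add_right inner_commute[of "fst s" q] distrib_left)
    ultimately show ?thesis
      by (simp only: sum_UNIV_option sum.distrib sum_distrib_left[symmetric])
  qed
  \<comment> \<open>The quadratic form of \<open>S\<close> is a variance.\<close>
  have var: "0 \<le> s \<bullet> S s" for s
    unfolding aS[symmetric] gaussian_process_variance[OF gp finite, where t = t', OF t', symmetric] by simp
  have char: "(\<integral>\<xi>. iexp (s \<bullet> X \<xi>) \<partial>M) = complex_of_real (exp (- (s \<bullet> S s) / 2))" for s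
    using gaussian_process_char[OF gp finite, where I = UNIV and t = t' and a = "a s", OF t'] by (simp only: aX aS)
  have [measurable]: "\<omega> u \<in> borel_measurable M" if "u \<in> T" for u
    using gp that unfolding gaussian_process_def by blast
  have "(\<lambda>\<xi>. \<omega> (t i) \<xi> \<bullet> x i) \<in> borel_measurable M" for i
    using t by measurable
  then have "(\<lambda>\<xi>. \<chi> i. \<omega> (t i) \<xi> \<bullet> x i) \<in> borel_measurable M"
    by (subst borel_measurable_euclidean_space) (auto simp: Basis_vec_def inner_axis)
  moreover have "(\<lambda>\<xi>. \<omega> ts \<xi> \<bullet> xs) \<in> borel_measurable M"
    using ts by measurable
  ultimately have X: "X \<in> borel_measurable M"
    unfolding X_def by (intro borel_measurable_Pair)
  obtain c where c: "c > 0" "\<And>w. (\<integral>\<xi>. exp (- (norm (\<tau>\<^sup>2 *\<^sub>R w + S w - X \<xi>))\<^sup>2 / (2 * \<tau>\<^sup>2)) \<partial>M) =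
      c * exp (- (w \<bullet> (\<tau>\<^sup>2 *\<^sub>R w + S w)) / 2)"
    using expectation_gaussian_kernel[OF \<open>prob_space M\<close> X linS symS var \<open>\<tau> > 0\<close> char] by blast
  have A: "\<tau>\<^sup>2 *\<^sub>R (s, r) + S (s, r) = (Q *v s + r *\<^sub>R q, q \<bullet> s + r * (\<kappa> + \<tau>\<^sup>2))" for s r
    by (simp add: S_def Q K_def[symmetric] matrix_vector_mult_add_rdistrib scaleR_matrix_vector_assoc[symmetric] algebra_simps)
  have pdA: "0 < w \<bullet> (\<tau>\<^sup>2 *\<^sub>R w + S w)" if "w \<noteq> 0" for w
    using that var[of w] \<open>\<tau> > 0\<close> by (simp add: inner_add_right add_pos_nonneg)
  \<comment> \<open>\<open>Q\<close> is the upper left block of the positive definite operator,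
    which is seen on vectors \<open>(s, 0)\<close>.\<close>
  have pdQ: "0 < s \<bullet> (Q *v s)" if "s \<noteq> 0" for s
    using pdA[of "(s, 0)"] that unfolding A by (simp add: zero_prod_def)
  have symQ: "transpose Q = Q"
    by (simp add: Q transpose_def vec_eq_iff mat_def inner_commute k_sym t)
  have detQ: "det Q > 0"
    by (rule det_pos[OF symQ pdQ])
  define R where "R = matrix_inv Q"
  have "invertible Q"
    using detQ by (simp add: invertible_det_nz)
  then have QR: "Q ** R = mat 1" and RQ: "R ** Q = mat 1"
    unfolding R_def matrix_inv_def invertible_def by (metis (mono_tags, lifting) someI_ex)+
  have symR: "transpose R = R"
    by (metis QR RQ matrix_mul_assoc matrix_mul_lid matrix_mul_rid matrix_transpose_mul symQ transpose_mat)
  have vR: "v = \<kappa> + \<tau>\<^sup>2 - q \<bullet> (R *v q)"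
    by (simp add: v \<kappa>_def R_def)
  \<comment> \<open>The operator maps \<open>(- (R *v q), 1)\<close> to \<open>(0, v)\<close>, so
    \<open>v\<close> is the value of the positive definite form at this vector.\<close>
  have "v > 0"
    using pdA[of "(- (R *v q), 1)"] unfolding A
    by (simp add: vR zero_prod_def matrix_vector_mul_assoc QR linear_neg[OF matrix_vector_mul_linear])
  have density: "normal_density (q \<bullet> (R *v z)) (sqrt v) u * mvn_density 0 Q z =
      exp (- (z \<bullet> (R *v z) + (u - q \<bullet> (R *v z))\<^sup>2 / v) / 2) / (sqrt (2 * pi * v) * sqrt ((2 * pi) ^ CARD('n) * det Q))" for z u
  proof -
    have "- (z \<bullet> (R *v z) + (u - q \<bullet> (R *v z))\<^sup>2 / v) / 2 = - (u - q \<bullet> (R *v z))\<^sup>2 / (2 * v) + - (z \<bullet> (R *v z)) / 2"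
      using \<open>v > 0\<close> by (simp add: field_simps)
    then show ?thesis
      using \<open>v > 0\<close> by (simp only: exp_add) (simp add: normal_density_def mvn_density_def R_def)
  qed
  show thesis
  proof
    \<comment> \<open>The constant \<open>c\<close> times the denominators of the two normal
      densities.\<close>
    show "c * (sqrt (2 * pi * v) * sqrt ((2 * pi) ^ CARD('n) * det Q)) > 0"
      using c(1) \<open>v > 0\<close> detQ by simp
    fix z u
    \<comment> \<open>\<open>(s, r)\<close> is the preimage of \<open>(z, u)\<close> under the
      positive definite operator, found by block elimination.\<close>
    define r where "r = (u - q \<bullet> (R *v z)) / v"
    define s where "s = R *v (z - r *\<^sub>R q)"
    note sol = bordered_solution[OF QR symR vR _ r_def s_def]
    have w: "\<tau>\<^sup>2 *\<^sub>R (s, r) + S (s, r) = (z, u)"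
      unfolding A using sol \<open>v > 0\<close> by simp
    show "(\<integral>\<xi>. exp (- (norm ((z, u) - (\<chi> i. \<omega> (t i) \<xi> \<bullet> x i, \<omega> ts \<xi> \<bullet> xs)))\<^sup>2 / (2 * \<tau>\<^sup>2)) \<partial>M) =
      c * (sqrt (2 * pi * v) * sqrt ((2 * pi) ^ CARD('n) * det Q)) * (normal_density (q \<bullet> (matrix_inv Q *v z)) (sqrt v) u * mvn_density 0 Q z)"
      using c(2)[of "(s, r)"] sol(3) \<open>v > 0\<close> detQ unfolding w R_def[symmetric] density X_def[symmetric] by simp
  qed
qed

section \<open>The predictive distribution\<close>

text \<open>Identifies the joint density of the independent noise terms, one per training point and
  one for the test point, with the kernel in \<open>expectation_gaussian_kernel\<close>.\<close>

lemma normal_density_product: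
  fixes a z :: "real^'n"
  assumes "\<tau> > 0"
  shows "(\<Prod>i\<in>UNIV. normal_density (a $ i) \<tau> (z $ i)) * normal_density b \<tau> u =
    (1 / sqrt (2 * pi * \<tau>\<^sup>2)) ^ Suc CARD('n) * exp (- (norm ((z, u) - (a, b)))\<^sup>2 / (2 * \<tau>\<^sup>2))"
proof -
  have "- (norm ((z, u) - (a, b)))\<^sup>2 / (2 * \<tau>\<^sup>2) =
      (\<Sum>i\<in>UNIV. - (z $ i - a $ i)\<^sup>2 / (2 * \<tau>\<^sup>2)) + - (u - b)\<^sup>2 / (2 * \<tau>\<^sup>2)"
    by (simp add: norm_Pair norm_vec_def L2_set_def sum_nonneg sum_negf diff_divide_distrib
        flip: sum_divide_distrib)
  then show ?thesis
    unfolding normal_density_def prod.distrib by (simp only: exp_add exp_sum[OF finite]) simp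
qed

text \<open>The Bochner integral of a nonintegrable function is 0, so the two sides could differ.
  Finiteness of the iterated integral makes the inner one finite almost everywhere, and then both
  conversions are exact.\<close>

lemma lebesgue_integral_iterated_eq_nn_integral:
  fixes f :: "'a::euclidean_space \<Rightarrow> 'b::euclidean_space \<Rightarrow> real"
  assumes f [measurable]: "case_prod f \<in> borel_measurable (borel \<Otimes>\<^sub>M borel)" and nn: "\<And>u z. 0 \<le> f u z"
    and fin: "(\<integral>\<^sup>+u. \<integral>\<^sup>+z. ennreal (f u z) \<partial>lborel \<partial>lborel) \<noteq> \<infinity>"
  shows "ennreal (\<integral>u. (\<integral>z. f u z \<partial>lborel) \<partial>lborel) = (\<integral>\<^sup>+u. \<integral>\<^sup>+z. ennreal (f u z) \<partial>lborel \<partial>lborel)"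
proof -
  have inner: "(\<integral>z. f u z \<partial>lborel) = enn2real (\<integral>\<^sup>+z. ennreal (f u z) \<partial>lborel)" for u
    by (rule integral_eq_nn_integral) (simp_all add: nn)
  have "AE u in lborel. (\<integral>\<^sup>+z. ennreal (f u z) \<partial>lborel) \<noteq> \<infinity>"
    using fin by (intro nn_integral_PInf_AE) simp_all
  then have "(\<integral>\<^sup>+u. ennreal (enn2real (\<integral>\<^sup>+z. ennreal (f u z) \<partial>lborel)) \<partial>lborel) = (\<integral>\<^sup>+u. \<integral>\<^sup>+z. ennreal (f u z) \<partial>lborel \<partial>lborel)"
    by (intro nn_integral_cong_AE) (auto simp: less_top elim!: eventually_mono)
  moreover have "(\<integral>u. (\<integral>z. f u z \<partial>lborel) \<partial>lborel) = enn2real (\<integral>\<^sup>+u. ennreal (enn2real (\<integral>\<^sup>+z. ennreal (f u z) \<partial>lborel)) \<partial>lborel)"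
    unfolding inner by (rule integral_eq_nn_integral) simp_all
  ultimately show ?thesis
    using fin by (simp add: less_top)
qed

lemma measurable_matrix_vector_mult [measurable (raw)]:
  fixes A :: "real^'n^'m"
  assumes "f \<in> borel_measurable N"
  shows "(\<lambda>w. A *v f w) \<in> borel_measurable N"
  using assms
  by (rule borel_measurable_continuous_on[OF linear_continuous_on[OF matrix_vector_mul_bounded_linear]])

text \<open>The factor \<open>D\<close> is the same for all \<open>y\<close> and \<open>b\<close>,
  which is what proportionality requires. The computation uses nonnegative integrals, which can be
  interchanged freely, and passes to Bochner integrals at the end.\<close>

lemma prob_labels_glm:
  fixes x :: "'n::finite \<Rightarrow> real^'m" and Q :: "real^'n^'n"
  assumes M: "prob_space M" and k: "psd_kernel T k"
    and gp: "gaussian_process M T (\<lambda>_. 0) (isotropic_kernel k) \<omega>"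
    and t: "\<And>i. t i \<in> T" and ts: "ts \<in> T" and \<tau>: "\<tau> > 0"
    and p: "binary_likelihood p"
    and drawn: "drawn_independently_given M T \<omega> (glm_observation p \<tau>) x t xs ts Z Y Zs Ys"
    and Q: "Q = (\<chi> i j. (x i \<bullet> x j) * k (t i) (t j)) + \<tau>\<^sup>2 *\<^sub>R mat 1"
    and q: "q = (\<chi> i. (x i \<bullet> xs) * k (t i) ts)"
    and v: "v = (xs \<bullet> xs) * k ts ts - q \<bullet> (matrix_inv Q *v q) + \<tau>\<^sup>2"
  obtains D where "D > 0"
    and "\<And>y b. \<P>(\<xi> in M. (\<forall>i. Y i \<xi> = y i) \<and> Ys \<xi> = b) =
      D * (\<integral>zs. (\<integral>z. pmf (p zs) b * normal_density (q \<bullet> (matrix_inv Q *v z)) (sqrt v) zs *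
                    (\<Prod>i\<in>UNIV. pmf (p (z $ i)) (y i)) * mvn_density 0 Q z \<partial>lborel) \<partial>lborel)"
proof -
  interpret prob_space M by fact
  interpret pair_sigma_finite M "lborel :: (real^'n) measure" ..
  interpret R: pair_sigma_finite M "lborel :: real measure" ..
  define U where "U \<xi> = (\<chi> i. \<omega> (t i) \<xi> \<bullet> x i)" for \<xi>
  define Us where "Us \<xi> = \<omega> ts \<xi> \<bullet> xs" for \<xi>
  have \<omega> [measurable]: "\<omega> a \<in> borel_measurable M" if "a \<in> T" for a
    using gp that unfolding gaussian_process_def by blast
  have [measurable]: "(\<lambda>\<xi>. U \<xi> $ i) \<in> borel_measurable M" for i
    unfolding U_def using t by simp
  have [measurable]: "U \<in> borel_measurable M"
    by (subst borel_measurable_euclidean_space) (auto simp: Basis_vec_def inner_axis)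
  have [measurable]: "Us \<in> borel_measurable M"
    unfolding Us_def using ts by measurable
  have [measurable]: "(\<lambda>z. pmf (p z) b) \<in> borel_measurable borel" for b
    using p by (simp add: binary_likelihood_def)
  have [measurable]: "(\<lambda>z. mvn_density 0 Q z) \<in> borel_measurable borel"
    unfolding mvn_density_def by measurable
  define G where "G u z \<xi> = exp (- (norm ((z, u) - (U \<xi>, Us \<xi>)))\<^sup>2 / (2 * \<tau>\<^sup>2))" for u z \<xi>
  define H where "H u z = normal_density (q \<bullet> (matrix_inv Q *v z)) (sqrt v) u * mvn_density 0 Q z" for u z
  obtain c where c: "c > 0" "\<And>z u. (\<integral>\<xi>. G u z \<xi> \<partial>M) = c * H u z"
    by (rule gaussian_process_smoothed_density[OF M k gp t ts \<tau> Q q v])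
      (rule that, assumption, simp add: G_def[abs_def] H_def U_def Us_def)
  \<comment> \<open>The sign is inherited from the expectation of the positive kernel
    \<open>G\<close>, with no need to inspect \<open>v\<close> or the determinant of
    \<open>Q\<close>.\<close>
  have H_nonneg: "0 \<le> H u z" for u z
  proof -
    have "0 \<le> (\<integral>\<xi>. G u z \<xi> \<partial>M)"
      by (simp add: G_def)
    then show ?thesis
      using c by (simp add: zero_le_mult_iff)
  qed
  have [measurable (raw)]: "(\<lambda>w. H (f w) (g w)) \<in> borel_measurable N"
    if [measurable]: "f \<in> borel_measurable N" "g \<in> borel_measurable N" for f g and N :: "'w measure"
    unfolding H_def normal_density_def by measurable
  have [measurable (raw)]: "(\<lambda>w. G (f w) (g w) (h w)) \<in> borel_measurable N"
    if [measurable]: "f \<in> borel_measurable N" "g \<in> borel_measurable N" "h \<in> N \<rightarrow>\<^sub>M M" for f g h and N :: "'w measure"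
    unfolding G_def by measurable
  define C where "C = (1 / sqrt (2 * pi * \<tau>\<^sup>2)) ^ Suc CARD('n)"
  have C: "C > 0"
    using \<tau> by (simp add: C_def)
  have main: "\<P>(\<xi> in M. (\<forall>i. Y i \<xi> = y i) \<and> Ys \<xi> = b) =
      C * c * (\<integral>zs. (\<integral>z. pmf (p zs) b * normal_density (q \<bullet> (matrix_inv Q *v z)) (sqrt v) zs *
                    (\<Prod>i\<in>UNIV. pmf (p (z $ i)) (y i)) * mvn_density 0 Q z \<partial>lborel) \<partial>lborel)" (is "?P = _ * ?I")
    for y b
  proof -
    define \<Phi> where "\<Phi> u z = pmf (p u) b * (\<Prod>i\<in>UNIV. pmf (p (z $ i)) (y i))" for u and z :: "real^'n"
    have \<Phi>_nonneg: "0 \<le> \<Phi> u z" for u z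
      by (simp add: \<Phi>_def prod_nonneg)
    have [measurable]: "(\<lambda>z::real^'n. z $ i) \<in> borel_measurable borel" for i
      by (intro borel_measurable_continuous_onI continuous_intros)
    have [measurable (raw)]: "(\<lambda>w. \<Phi> (f w) (g w)) \<in> borel_measurable N"
      if [measurable]: "f \<in> borel_measurable N" "g \<in> borel_measurable N" for f g and N :: "'w measure"
      unfolding \<Phi>_def by measurable
    have "ennreal ?P = (\<integral>\<^sup>+\<xi>. ennreal ((\<Prod>i\<in>UNIV. measure (glm_observation p \<tau> (x i) (\<omega> (t i) \<xi>)) (UNIV \<times> {y i})) *
        measure (glm_observation p \<tau> xs (\<omega> ts \<xi>)) (UNIV \<times> {b})) \<partial>M)"
      by (rule prob_labels[OF M \<omega> drawn])
    also have "\<dots> = (\<integral>\<^sup>+\<xi>. (\<integral>\<^sup>+u. (\<integral>\<^sup>+z. ennreal (C * \<Phi> u z) * ennreal (G u z \<xi>) \<partial>lborel) \<partial>lborel) \<partial>M)"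
    proof (rule nn_integral_cong)
      fix \<xi>
      let ?f = "\<lambda>i z. ennreal (pmf (p z) (y i)) * ennreal (normal_density (U \<xi> $ i) \<tau> z)"
      let ?g = "\<lambda>u. ennreal (pmf (p u) b) * ennreal (normal_density (Us \<xi>) \<tau> u)"
      have "ennreal ((\<Prod>i\<in>UNIV. measure (glm_observation p \<tau> (x i) (\<omega> (t i) \<xi>)) (UNIV \<times> {y i})) *
          measure (glm_observation p \<tau> xs (\<omega> ts \<xi>)) (UNIV \<times> {b})) =
          (\<Prod>i\<in>UNIV. ennreal (measure (glm_observation p \<tau> (x i) (\<omega> (t i) \<xi>)) (UNIV \<times> {y i}))) *
          ennreal (measure (glm_observation p \<tau> xs (\<omega> ts \<xi>)) (UNIV \<times> {b}))"
        by (simp add: ennreal_mult prod_nonneg prod_ennreal)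
      \<comment> \<open>Each label contributes an integral over its own latent variable; the product
        over the training points then becomes a single integral over the vector
        \<open>z\<close>.\<close>
      also have "\<dots> = (\<Prod>i\<in>UNIV. (\<integral>\<^sup>+z. ?f i z \<partial>lborel)) * (\<integral>\<^sup>+u. ?g u \<partial>lborel)"
        unfolding measure_glm_observation_label[OF p \<tau>] by (simp add: U_def Us_def)
      also have "\<dots> = (\<integral>\<^sup>+z. (\<Prod>i\<in>UNIV. ?f i (z $ i)) \<partial>(lborel :: (real^'n) measure)) * (\<integral>\<^sup>+u. ?g u \<partial>lborel)"
        by (subst nn_integral_lborel_vec_prod) simp_all
      also have "\<dots> = (\<integral>\<^sup>+u. (\<integral>\<^sup>+z. (\<Prod>i\<in>UNIV. ?f i (z $ i)) * ?g u \<partial>(lborel :: (real^'n) measure)) \<partial>lborel)"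
        by (subst nn_integral_multc, simp, subst nn_integral_cmult) simp_all
      also have "\<dots> = (\<integral>\<^sup>+u. (\<integral>\<^sup>+z. ennreal (C * \<Phi> u z) * ennreal (G u z \<xi>) \<partial>lborel) \<partial>lborel)"
      proof (intro nn_integral_cong)
        fix u and z :: "real^'n"
        have "(\<Prod>i\<in>UNIV. ?f i (z $ i)) * ?g u =
            ennreal (\<Phi> u z * ((\<Prod>i\<in>UNIV. normal_density (U \<xi> $ i) \<tau> (z $ i)) * normal_density (Us \<xi>) \<tau> u))"
          by (simp add: \<Phi>_def prod.distrib prod_ennreal prod_nonneg mult_ac flip: ennreal_mult)
        also have "\<dots> = ennreal (C * \<Phi> u z) * ennreal (G u z \<xi>)"
          unfolding normal_density_product[OF \<tau>] C_def[symmetric] G_def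
          using C by (simp add: \<Phi>_nonneg mult_ac flip: ennreal_mult)
        finally show "(\<Prod>i\<in>UNIV. ?f i (z $ i)) * ?g u = ennreal (C * \<Phi> u z) * ennreal (G u z \<xi>)" .
      qed
      finally show "ennreal ((\<Prod>i\<in>UNIV. measure (glm_observation p \<tau> (x i) (\<omega> (t i) \<xi>)) (UNIV \<times> {y i})) *
          measure (glm_observation p \<tau> xs (\<omega> ts \<xi>)) (UNIV \<times> {b})) =
          (\<integral>\<^sup>+u. (\<integral>\<^sup>+z. ennreal (C * \<Phi> u z) * ennreal (G u z \<xi>) \<partial>lborel) \<partial>lborel)" .
    qed
    \<comment> \<open>Two interchanges move the expectation innermost, where it acts on
      \<open>G\<close> alone.\<close>
    also have "\<dots> = (\<integral>\<^sup>+u. (\<integral>\<^sup>+\<xi>. (\<integral>\<^sup>+z. ennreal (C * \<Phi> u z) * ennreal (G u z \<xi>) \<partial>lborel) \<partial>M) \<partial>lborel)"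
      by (rule R.Fubini'[symmetric]) measurable
    also have "\<dots> = (\<integral>\<^sup>+u. (\<integral>\<^sup>+z. (\<integral>\<^sup>+\<xi>. ennreal (C * \<Phi> u z) * ennreal (G u z \<xi>) \<partial>M) \<partial>lborel) \<partial>lborel)"
      by (intro nn_integral_cong Fubini'[symmetric]) measurable
    also have "\<dots> = (\<integral>\<^sup>+u. (\<integral>\<^sup>+z. ennreal (C * c) * ennreal (\<Phi> u z * H u z) \<partial>lborel) \<partial>lborel)"
    proof (intro nn_integral_cong)
      fix u z
      have "(\<lambda>\<xi>. G u z \<xi>) \<in> borel_measurable M"
        by measurable
      then have "integrable M (G u z)"
        by (intro integrable_const_bound[of _ 1]) (auto simp: G_def)
      then have "(\<integral>\<^sup>+\<xi>. ennreal (G u z \<xi>) \<partial>M) = ennreal (c * H u z)"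
        unfolding c(2)[symmetric] by (rule nn_integral_eq_integral) (simp add: G_def)
      then show "(\<integral>\<^sup>+\<xi>. ennreal (C * \<Phi> u z) * ennreal (G u z \<xi>) \<partial>M) = ennreal (C * c) * ennreal (\<Phi> u z * H u z)"
        using C c(1) by (subst nn_integral_cmult) (simp_all add: \<Phi>_nonneg H_nonneg mult_ac flip: ennreal_mult)
    qed
    also have "\<dots> = ennreal (C * c) * (\<integral>\<^sup>+u. (\<integral>\<^sup>+z. ennreal (\<Phi> u z * H u z) \<partial>lborel) \<partial>lborel)"
      by (simp add: nn_integral_cmult)
    finally have P: "ennreal ?P = ennreal (C * c) * (\<integral>\<^sup>+u. (\<integral>\<^sup>+z. ennreal (\<Phi> u z * H u z) \<partial>lborel) \<partial>lborel)" .
    \<comment> \<open>A positive multiple of this integral is a probability, hence finite.\<close>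
    have "(\<integral>\<^sup>+u. (\<integral>\<^sup>+z. ennreal (\<Phi> u z * H u z) \<partial>lborel) \<partial>lborel) \<noteq> \<infinity>"
    proof
      assume "(\<integral>\<^sup>+u. (\<integral>\<^sup>+z. ennreal (\<Phi> u z * H u z) \<partial>lborel) \<partial>lborel) = \<infinity>"
      with P C c(1) show False
        by (simp add: ennreal_mult_top)
    qed
    then have "ennreal (\<integral>u. (\<integral>z. \<Phi> u z * H u z \<partial>lborel) \<partial>lborel) = (\<integral>\<^sup>+u. (\<integral>\<^sup>+z. ennreal (\<Phi> u z * H u z) \<partial>lborel) \<partial>lborel)"
      by (intro lebesgue_integral_iterated_eq_nn_integral) (simp_all add: \<Phi>_nonneg H_nonneg)
    moreover have I: "(\<integral>u. (\<integral>z. \<Phi> u z * H u z \<partial>lborel) \<partial>lborel) = ?I"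
      by (simp add: \<Phi>_def H_def mult_ac)
    ultimately have "ennreal ?P = ennreal (C * c) * ennreal ?I"
      using P by simp
    moreover have "0 \<le> ?I"
      unfolding I[symmetric] by (intro integral_nonneg_AE AE_I2 mult_nonneg_nonneg H_nonneg \<Phi>_nonneg)
    ultimately have "ennreal ?P = ennreal (C * c * ?I)"
      using C c(1) by (subst ennreal_mult) (simp_all add: mult_nonneg_nonneg)
    then show ?thesis
      using C c(1) \<open>0 \<le> ?I\<close> by (subst (asm) ennreal_inj) (simp_all add: mult_nonneg_nonneg)
  qed
  show thesis
    by (rule that[of "C * c"]) (use C c(1) main in simp_all)
qed


theorem theorem4:
  fixes M :: "'a measure"
    and T :: "'t set"
    and k :: "'t \<Rightarrow> 't \<Rightarrow> real"
    and \<omega> :: "'t \<Rightarrow> 'a \<Rightarrow> real^'m"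
    and \<X> :: "(real^'m) set"
    and x :: "'n::finite \<Rightarrow> real^'m" and xs :: "real^'m"
    and t :: "'n \<Rightarrow> 't" and ts :: 't
    and p :: "real \<Rightarrow> nat pmf" and \<tau> :: real
    and Z :: "'n \<Rightarrow> 'a \<Rightarrow> real" and Zs :: "'a \<Rightarrow> real"
    and Y :: "'n \<Rightarrow> 'a \<Rightarrow> nat" and Ys :: "'a \<Rightarrow> nat"
    and y :: "'n \<Rightarrow> nat"
    and K\<^sub>T K :: "real^'n^'n" and kv :: "real^'n"
    and \<mu> :: "real^'n \<Rightarrow> real" and v :: real
  assumes "prob_space M"
    and "psd_kernel T k"
    and "\<And>i. x i \<in> \<X>" and "xs \<in> \<X>"
    and "\<And>i. t i \<in> T" and "ts \<in> T"
    and "gaussian_process M T (\<lambda>_. 0) (isotropic_kernel k) \<omega>"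
    and "\<tau> > 0"
    and "binary_likelihood p"
    and "drawn_independently_given M T \<omega> (glm_observation p \<tau>) x t xs ts Z Y Zs Ys"
    and "\<And>i. y i \<in> {0, 1}"
    and "\<P>(\<xi> in M. \<forall>i. Y i \<xi> = y i) > 0"
    and "K\<^sub>T = (\<chi> i j. k (t i) (t j))" and "positive_definite K\<^sub>T"
    and "K = (\<chi> i j. (x i \<bullet> x j) * k (t i) (t j))"
    and "kv = (\<chi> i. (x i \<bullet> xs) * k (t i) ts)"
    and "\<mu> = (\<lambda>z. kv \<bullet> (matrix_inv (K + \<tau>\<^sup>2 *\<^sub>R mat 1) *v z))"
    and "v = (xs \<bullet> xs) * k ts ts - kv \<bullet> (matrix_inv (K + \<tau>\<^sup>2 *\<^sub>R mat 1) *v kv) + \<tau>\<^sup>2"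
  shows "\<exists>C>0. \<forall>b\<in>{0, 1}.
    \<P>(\<xi> in M. Ys \<xi> = b \<bar> \<forall>i. Y i \<xi> = y i) =
    C * (\<integral>zs. (\<integral>z. pmf (p zs) b * normal_density (\<mu> z) (sqrt v) zs *
                    (\<Prod>i\<in>UNIV. pmf (p (z $ i)) (y i)) *
                    mvn_density 0 (K + \<tau>\<^sup>2 *\<^sub>R mat 1) z \<partial>lborel) \<partial>lborel)"
proof -
  interpret prob_space M by fact
  let ?Q = "K + \<tau>\<^sup>2 *\<^sub>R mat 1"
  have Q: "?Q = (\<chi> i j. (x i \<bullet> x j) * k (t i) (t j)) + \<tau>\<^sup>2 *\<^sub>R mat 1"
    using assms(15) by simp
  obtain D where D: "D > 0" "\<And>y b. \<P>(\<xi> in M. (\<forall>i. Y i \<xi> = y i) \<and> Ys \<xi> = b) =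
      D * (\<integral>zs. (\<integral>z. pmf (p zs) b * normal_density (kv \<bullet> (matrix_inv ?Q *v z)) (sqrt v) zs *
                    (\<Prod>i\<in>UNIV. pmf (p (z $ i)) (y i)) * mvn_density 0 ?Q z \<partial>lborel) \<partial>lborel)"
    by (rule prob_labels_glm[OF assms(1,2,7,5,6,8,9,10) Q assms(16,18)]) (rule that)
  show ?thesis
  proof (intro exI conjI ballI)
    \<comment> \<open>The conditional probability is the joint one divided by the probability of the
      training labels, which does not depend on \<open>b\<close> and is positive by
      assumption.\<close>
    show "D / \<P>(\<xi> in M. \<forall>i. Y i \<xi> = y i) > 0"
      using D(1) assms(12) by simp
    fix b :: nat
    show "\<P>(\<xi> in M. Ys \<xi> = b \<bar> \<forall>i. Y i \<xi> = y i) = D / \<P>(\<xi> in M. \<forall>i. Y i \<xi> = y i) *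
      (\<integral>zs. (\<integral>z. pmf (p zs) b * normal_density (\<mu> z) (sqrt v) zs *
                    (\<Prod>i\<in>UNIV. pmf (p (z $ i)) (y i)) * mvn_density 0 ?Q z \<partial>lborel) \<partial>lborel)"
      using D(2)[of y b] by (simp add: cond_prob_def assms(17) conj_commute)
  qed
qed

end
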